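(* Let $G$ be a $c$-cyclic graph on $n$ vertices with vertex degrees $d_1,\dots,d_n$, $0\le c\le 6$, $n\ge c+2$, and let $\rho=\sum_{j=1}^n \frac{1}{d_j}$. (c=0) If $G$ is a tree, then $\dfrac{n+2}{2}\le\rho\le (n-1)+\dfrac{1}{n-1}$, where the lower and the upper bounds are attained if and only if $G=P_n$ and $G=S_n$, respectively. (c=1) If $G$ is unicyclic, then $\dfrac{n}{2}\le\rho\le (n-2)+\dfrac{1}{n-1}$, where the lower and the upper bounds are attained if and only if $G=C_n$ and $G=S_n^{+}$, respectively. (c=2) If $G$ is bicyclic, then $\dfrac{n-2}{2}+\dfrac23\le\rho\le (n-3)+\dfrac{1}{n-1}+\dfrac13$; the upper bound is attained by bicyclic graphs with degree sequence $[n-1,3,2^2,1^{n-4}]$ and the lower bound by bicyclic graphs with degree sequence $[3^2,2^{n-2}]$. (c=3) If $G$ is tricyclic, then $\dfrac{n-4}{2}+\dfrac43\le\rho\le (n-3)+\dfrac{1}{n-1}$; for $n=8$ the lower and upper bounds are achieved by tricyclic graphs with degree sequences $[3^4,2^4]$ and $[7,3^3,1^4]$, respectively. (c=4) If $G$ is tetracyclic, then $\dfrac{n-2}{2}\le\rho\le (n-5)+\dfrac{1}{n-1}+\dfrac{17}{12}$; for $n=8$ the lower and upper bounds are achieved by tetracyclic graphs with degree sequences $[3^6,2^2]$ and $[7,4,3^2,2,1^3]$, respectively. (c=5) If $G$ is pentacyclic, then $\dfrac{n-8}{2}+\dfrac83\le\rho\le (n-5)+\dfrac{1}{n-1}+\dfrac76$;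 for $n=9$ the lower and upper bounds are achieved by pentacyclic graphs with degree sequences $[3^8,2]$ and $[8,4^2,3^2,1^4]$, respectively. (c=6) If $G$ is hexacyclic, then $\dfrac{n-10}{2}+\dfrac{10}{3}\le\rho\le (n-4)+\dfrac{1}{n-1}$; for $n=11$ the lower and upper bounds are achieved by hexacyclic graphs with degree sequences $[3^{10},2]$ and $[10,4^4,1^6]$, respectively.
   Context: All graphs are finite, simple, connected and undirected. A graph with $n$ vertices and $m$ edges is $c$-cyclic if $c=m-n+1$; for $c=0,\dots,6$ it is called a tree, unicyclic, bicyclic, tricyclic, tetracyclic, pentacyclic, hexacyclic graph. $\rho$ is called the inverse degree of $G$. $P_n$, $S_n$ and $C_n$ are the path, the star and the cycle on $n$ vertices; $S_n^{+}$ is the graph obtained from $S_n$ by joining two pendant vertices with an edge. The notation $[x_1^{\alpha_1},\dots,x_p^{\alpha_p}]$ for a degree sequence means that $x_i$ occurs $\alpha_i$ times (exponents are multiplicities; exponent $1$ is omitted, exponent $0$ means the entry is absent). *)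

theory Defs
  imports Complex_Main "HOL-Library.Multiset" "Graph_Theory.Graph_Theory"
begin

text \<open>
  A finite simple undirected graph is a \<^locale>\<open>pair_graph\<close>: an edge between \<open>u\<close> and \<open>v\<close> is
  represented by the two arcs \<open>(u, v)\<close> and \<open>(v, u)\<close>. Hence the degree of a vertex is its
  \<^const>\<open>out_degree\<close>, while edges have to be counted as unordered pairs.
\<close>

definition edges :: "'a pair_pre_digraph \<Rightarrow> 'a set set" where
  "edges G = (\<lambda>(u, v). {u, v}) ` parcs G"

abbreviation degree :: "'a pair_pre_digraph \<Rightarrow> 'a \<Rightarrow> nat" where
  "degree G v \<equiv> out_degree (with_proj G) v"

definition c_cyclic :: "nat \<Rightarrow> 'a pair_pre_digraph \<Rightarrow> bool" where
  "c_cyclic c G \<longleftrightarrow> pair_graph G \<and> connected (with_proj G) \<and>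
     int c = int (card (edges G)) - int (card (pverts G)) + 1"

definition inverse_degree :: "'a pair_pre_digraph \<Rightarrow> real" where
  "inverse_degree G = (\<Sum>v\<in>pverts G. 1 / real (degree G v))"

text \<open>Degree sequences are compared up to reordering: a list \<open>ds\<close> stands for \<open>mset ds\<close>.\<close>

definition has_degree_seq :: "'a pair_pre_digraph \<Rightarrow> nat list \<Rightarrow> bool" where
  "has_degree_seq G ds \<longleftrightarrow> image_mset (degree G) (mset_set (pverts G)) = mset ds"

abbreviation isomorphic :: "'a pair_pre_digraph \<Rightarrow> 'b pair_pre_digraph \<Rightarrow> bool" where
  "isomorphic G H \<equiv> digraph_iso (with_proj G) (with_proj H)"

definition path_graph :: "nat \<Rightarrow> nat pair_pre_digraph" where
  "path_graph n = \<lparr> pverts = {..<n},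
     parcs = {(i, j). i < n \<and> j < n \<and> (j = Suc i \<or> i = Suc j)} \<rparr>"

text \<open>Vertex \<open>0\<close> is the centre of the star; the other vertices are pendant once \<open>n \<ge> 3\<close>.\<close>

definition star_graph :: "nat \<Rightarrow> nat pair_pre_digraph" where
  "star_graph n = \<lparr> pverts = {..<n},
     parcs = {(i, j). i < n \<and> j < n \<and> i \<noteq> j \<and> (i = 0 \<or> j = 0)} \<rparr>"

text \<open>The following two graphs are only meaningful for \<open>n \<ge> 3\<close>.\<close>

definition cycle_graph :: "nat \<Rightarrow> nat pair_pre_digraph" where
  "cycle_graph n = \<lparr> pverts = {..<n},
     parcs = {(i, j). i < n \<and> j < n \<and> (j = Suc i mod n \<or> i = Suc j mod n)} \<rparr>"

definition star_plus_graph :: "nat \<Rightarrow> nat pair_pre_digraph" where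
  "star_plus_graph n = \<lparr> pverts = {..<n},
     parcs = parcs (star_graph n) \<union> {(1, 2), (2, 1)} \<rparr>"

text \<open>Vertices in \<^typ>\<open>nat\<close> are no restriction, since the graphs are finite.\<close>

definition attained_by :: "nat \<Rightarrow> nat \<Rightarrow> nat list \<Rightarrow> real \<Rightarrow> bool" where
  "attained_by c n ds r \<longleftrightarrow> (\<exists>H :: nat pair_pre_digraph.
     c_cyclic c H \<and> card (pverts H) = n \<and> has_degree_seq H ds \<and> inverse_degree H = r)"

end

theory Submission
  imports Defs
begin

text \<open>
  Lower bounds: for integers \<open>d \<ge> 1\<close>, \<open>1 / d\<close> lies above the chord of \<open>1 / x\<close> through two consecutive
  integers \<open>k, k + 1\<close> (\<open>k = 1\<close> for trees, \<open>k = 2\<close> otherwise), and \<open>\<Sum> d\<^sub>v = 2 (n + c - 1)\<close>.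

  Upper bounds: let \<open>x\<close> be a vertex of maximal degree and \<open>T\<close> a breadth-first spanning tree rooted at
  \<open>x\<close>. It contains all edges at \<open>x\<close>, so the remaining \<open>c\<close> edges form a graph with degrees \<open>e\<^sub>v\<close> that
  avoids \<open>x\<close>. Rehanging all tree edges onto \<open>x\<close> replaces the degrees by \<open>n - 1\<close> and \<open>1 + e\<^sub>v\<close>, and by
  convexity this increases the inverse degree, strictly unless \<open>x\<close> already dominates the graph. It remains to
  minimise \<open>\<Sum> e\<^sub>v / (1 + e\<^sub>v)\<close> over the graphs with \<open>c \<le> 6\<close> edges.
\<close>

section \<open>Simple graphs as symmetric relations\<close>

text \<open>Convexity of 1/d alone pushes the excess degree onto as few vertices as possible,
  towards sequences that no simple graph has, so graphicality must enter the upper bounds. Splitting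
  off a spanning tree confines it to a graph with c edges, a problem in which n no longer occurs.
  There e/(1+e) is concave and favours few vertices of extreme degree. Its chord bound is sharp for
  K_2, the path on three vertices, K_3 and K_4, that is for c = 1, 2, 3, 6. For c = 4 and c = 5 on
  four vertices it undershoots, and only there does the argument look at who is adjacent to whom.
  Graphs are relations on a fixed vertex set, so that the tree, the remaining edges and the
  restriction to non-isolated vertices are all instances of one locale.\<close>

locale simple_rel =
  fixes V :: "'a set" and R :: "'a rel"
  assumes finite_V: "finite V"
    and sub: "R \<subseteq> V \<times> V"
    and sym: "sym R"
    and irrefl: "irrefl R"
begin

lemma finite_nbrs: "finite (R `` {v})"
  using finite_V sub by (blast intro: finite_subset)

lemma finite_R: "finite R"
  using finite_V sub by (blast intro: finite_subset)

lemma not_self: "(v, v) \<notin> R"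
  using irrefl by (auto simp: irrefl_def)

lemma symmetric_arc: "(u, v) \<in> R \<Longrightarrow> (v, u) \<in> R"
  using sym by (auto dest: symD)

lemma in_V: "(u, v) \<in> R \<Longrightarrow> u \<in> V \<and> v \<in> V"
  using sub by blast

lemma sum_degrees: "(\<Sum>v\<in>V. card (R `` {v})) = card R"
proof -
  have "R = Sigma V (\<lambda>v. R `` {v})" using sub by auto
  then have "card R = card (Sigma V (\<lambda>v. R `` {v}))" by simp
  also have "\<dots> = (\<Sum>v\<in>V. card (R `` {v}))"
    by (rule card_SigmaI) (use finite_V finite_nbrs in auto)
  finally show ?thesis by simp
qed

text \<open>The fibre of {u, v} consists of the arcs (u, v) and (v, u), which are distinct because R
  is irreflexive.\<close>

lemma card_eq_twice_edges: "card R = 2 * card ((\<lambda>(u, v). {u, v}) ` R)"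
proof -
  let ?f = "\<lambda>(u, v). {u, v}"
  have fib: "card {a \<in> R. ?f a = e} = 2" if "e \<in> ?f ` R" for e
  proof -
    from that obtain u v where uv: "(u, v) \<in> R" "e = {u, v}" by force
    have "(a, b) \<in> {a \<in> R. ?f a = e} \<longleftrightarrow> (a, b) \<in> {(u, v), (v, u)}" for a b
    proof -
      have "{a, b} = {u, v} \<longleftrightarrow> a = u \<and> b = v \<or> a = v \<and> b = u" by (rule doubleton_eq_iff)
      then show ?thesis using uv(1) symmetric_arc[OF uv(1)] by (simp add: uv(2)) blast
    qed
    then have "{a \<in> R. ?f a = e} = {(u, v), (v, u)}" by (intro set_eqI) (simp only: split_paired_all)
    moreover have "u \<noteq> v" using uv(1) not_self by blast
    ultimately show ?thesis by simp
  qed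
  have "card R = (\<Sum>e\<in>?f ` R. card {a \<in> R. ?f a = e})"
    using sum.image_gen[OF finite_R, of "\<lambda>_. 1::nat" ?f] by simp
  also have "\<dots> = (\<Sum>e\<in>?f ` R. 2)" by (rule sum.cong) (use fib in auto)
  finally show ?thesis by simp
qed

lemma degree_le: "v \<in> V \<Longrightarrow> card (R `` {v}) \<le> card V - 1"
proof -
  assume v: "v \<in> V"
  have "R `` {v} \<subseteq> V - {v}" using sub not_self by auto
  then have "card (R `` {v}) \<le> card (V - {v})"
    using finite_V by (intro card_mono) auto
  then show ?thesis using v by simp
qed

lemma sum_over_nonisolated:
  fixes g :: "nat \<Rightarrow> 'b::comm_monoid_add"
  assumes "g 0 = 0"
  shows "(\<Sum>v\<in>V. g (card (R `` {v}))) = (\<Sum>v\<in>{v\<in>V. R `` {v} \<noteq> {}}. g (card (R `` {v})))"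
  using finite_V assms by (intro sum.mono_neutral_right) auto

end

section \<open>The least spread of a graph with at most six edges\<close>

text \<open>The entries are the values of \<open>\<Sum> e / (1 + e)\<close> over the degrees \<open>e\<close> of, in turn, the empty
  graph, an edge, a path on three vertices, a triangle, a triangle with a pendant edge, \<open>K\<^sub>4\<close> minus an
  edge, and \<open>K\<^sub>4\<close>.\<close>

definition min_spread :: "nat \<Rightarrow> real" where
  "min_spread c = [0, 1, 5/3, 2, 31/12, 17/6, 3] ! c"

lemma nat_le6_cases:
  fixes c :: nat
  assumes "c \<le> 6"
  obtains "c = 0" | "c = 1" | "c = 2" | "c = 3" | "c = 4" | "c = 5" | "c = 6"
proof -
  have "c \<in> {0, 1, 2, 3, 4, 5, 6}" using assms by auto
  then show thesis using that by blast
qed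

lemma min_spread_simps [simp]:
  "min_spread 0 = 0" "min_spread 1 = 1" "min_spread (Suc 0) = 1" "min_spread 2 = 5/3" "min_spread 3 = 2"
  "min_spread 4 = 31/12" "min_spread 5 = 17/6" "min_spread 6 = 3"
  by (simp_all add: min_spread_def)

text \<open>The function e/(1+e) is concave, and the right-hand side is its chord through e = 1 and
  e = k - 1, the extreme degrees of a non-isolated vertex among k vertices.\<close>

lemma spread_chord:
  fixes e k :: nat
  assumes "1 \<le> e" "e \<le> k - 1"
  shows "real e / (1 + real e) \<ge> 1/2 + (real e - 1) / (2 * real k)"
proof -
  have "real e / (1 + real e) - 1/2 = (real e - 1) / (2 * (1 + real e))"
    by (simp add: field_simps)
  also have "\<dots> \<ge> (real e - 1) / (2 * real k)"
    using assms by (intro divide_left_mono) auto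
  finally show ?thesis by simp
qed

text \<open>The right-hand side is the chord bound summed over k vertices with degree sum 2c, and 2c
  \<le> k(k - 1) says that c edges fit on k vertices. For the two excluded pairs it gives 5/2 and
  11/4, below 31/12 and 17/6.\<close>

lemma min_spread_small:
  fixes c k :: nat
  assumes "c \<noteq> 0" "c \<le> 6" "2 * c \<le> k * (k - 1)" "k \<le> 6" "\<not> (k = 4 \<and> (c = 4 \<or> c = 5))"
  shows "min_spread c \<le> real k / 2 + (real (2 * c) - real k) / (2 * real k)"
  by (rule nat_le6_cases[OF assms(2)]; rule nat_le6_cases[OF assms(4)]; use assms in simp)

text \<open>Isolated vertices contribute 0, so only the number k of the others matters. From k = 7
  on the chord bound already yields 3, the largest entry of \<open>min_spread\<close>. Smaller k are
  a finite check, except for c = 4, 5 on four vertices, where the multiplicities of the degrees 1,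
  2, 3 are analysed.\<close>

lemma (in simple_rel) min_spread_le:
  assumes c: "card R = 2 * c" "c \<le> 6"
  shows "min_spread c \<le> (\<Sum>v\<in>V. real (card (R `` {v})) / (1 + real (card (R `` {v}))))"
proof (cases "c = 0")
  case True
  then show ?thesis by (simp add: sum_nonneg)
next
  case c0: False
  define e where "e v = card (R `` {v})" for v
  define K where "K = {v\<in>V. R `` {v} \<noteq> {}}"
  define k where "k = card K"
  have finK: "finite K" using finite_V by (simp add: K_def)
  have R_K: "R \<subseteq> K \<times> K" using sub symmetric_arc by (auto simp: K_def)
  interpret K: simple_rel K R
    by unfold_locales (use finK R_K sym irrefl in auto)
  have e_ge: "1 \<le> e v" if "v \<in> K" for v
    using that finite_nbrs[of v] unfolding e_def K_def by (simp add: Suc_leI card_gt_0_iff)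
  have e_le: "e v \<le> k - 1" if "v \<in> K" for v
    using K.degree_le[OF that] by (simp add: e_def k_def)
  have sum_e: "(\<Sum>v\<in>K. e v) = 2 * c"
    using K.sum_degrees c by (simp add: e_def)
  have goal_K: "(\<Sum>v\<in>V. real (e v) / (1 + real (e v))) = (\<Sum>v\<in>K. real (e v) / (1 + real (e v)))"
    using sum_over_nonisolated[of "\<lambda>d. real d / (1 + real d)"] by (simp add: e_def K_def)
  have "(\<Sum>v\<in>K. 1/2 + (real (e v) - 1) / (2 * real k)) \<le> (\<Sum>v\<in>K. real (e v) / (1 + real (e v)))"
    by (rule sum_mono) (use spread_chord e_ge e_le in blast)
  moreover have "(\<Sum>v\<in>K. 1/2 + (real (e v) - 1) / (2 * real k))
      = real k / 2 + (real (\<Sum>v\<in>K. e v) - real k) / (2 * real k)"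
    by (simp add: sum.distrib sum_subtractf k_def flip: sum_divide_distrib)
  ultimately have bound: "real k / 2 + (real (2 * c) - real k) / (2 * real k) \<le> (\<Sum>v\<in>K. real (e v) / (1 + real (e v)))"
    using sum_e by simp
  have "(\<Sum>v\<in>K. e v) \<le> (\<Sum>v\<in>K. k - 1)" by (rule sum_mono) (use e_le in auto)
  then have ck: "2 * c \<le> k * (k - 1)" using sum_e by (simp add: k_def)
  have exact: "min_spread c \<le> (\<Sum>v\<in>K. real (e v) / (1 + real (e v)))" if k4: "k = 4" and c45: "c = 4 \<or> c = 5"
  proof -
    define S where "S i = {v\<in>K. e v = i}" for i
    have range: "e ` K \<subseteq> {1, 2, 3}"
      using e_ge e_le k4 by (fastforce simp: numeral_eq_Suc)
    have split: "(\<Sum>v\<in>K. g (e v)) = real (card (S 1)) * g 1 + real (card (S 2)) * g 2 + real (card (S 3)) * g 3"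
      for g :: "nat \<Rightarrow> real"
    proof -
      have "(\<Sum>i\<in>{1,2,3}. \<Sum>v\<in>S i. g (e v)) = (\<Sum>v\<in>K. g (e v))"
        unfolding S_def by (rule sum.group) (use finK range in auto)
      moreover have "(\<Sum>v\<in>S i. g (e v)) = real (card (S i)) * g i" for i
        by (simp add: S_def)
      ultimately show ?thesis by simp
    qed
    have n: "real (card (S 1)) + real (card (S 2)) + real (card (S 3)) = 4"
      using split[of "\<lambda>_. 1"] k4 by (simp add: k_def)
    have "(\<Sum>v\<in>K. real (e v)) = 2 * real c"
      using sum_e by (metis of_nat_mult of_nat_numeral of_nat_sum)
    then have s: "real (card (S 1)) + 2 * real (card (S 2)) + 3 * real (card (S 3)) = 2 * real c"
      using split[of real] by simp
    \<comment> \<open>The chord bound is too weak for \<open>k = 4\<close>, as it does not exclude the degrees \<open>3, 3, 1, 1\<close> and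
      \<open>3, 3, 3, 1\<close>. But a vertex of degree 3 is adjacent to all other vertices of \<open>K\<close>, in particular to the leaf.\<close>
    have leaf: "card (S 3) \<le> 1" if "S 1 \<noteq> {}"
    proof -
      from that obtain v where v: "v \<in> K" "e v = 1" by (auto simp: S_def)
      have "S 3 \<subseteq> R `` {v}"
      proof
        fix a assume "a \<in> S 3"
        then have a: "a \<in> K" "e a = 3" by (auto simp: S_def)
        have "R `` {a} \<subseteq> K - {a}" using R_K not_self by auto
        moreover have "card (K - {a}) = 3" using a k4 finK by (simp add: k_def)
        ultimately have nbrs: "R `` {a} = K - {a}"
          using a finK unfolding e_def by (intro card_subset_eq) auto
        have "v \<noteq> a" using v a by auto
        then have "v \<in> R `` {a}" unfolding nbrs using v by simp
        then show "a \<in> R `` {v}" using symmetric_arc by simp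
      qed
      then have "card (S 3) \<le> card (R `` {v})" by (intro card_mono finite_nbrs)
      then show ?thesis using v by (simp add: e_def)
    qed
    have cases1: "card (S 1) = 0 \<or> card (S 3) \<le> 1"
      using leaf by (cases "S 1 = {}") auto
    have sp: "(\<Sum>v\<in>K. real (e v) / (1 + real (e v)))
      = real (card (S 1)) / 2 + 2 * real (card (S 2)) / 3 + 3 * real (card (S 3)) / 4"
      using split[of "\<lambda>i. real i / (1 + real i)"] by simp
    have cases2: "real (card (S 1)) = 0 \<or> real (card (S 3)) \<le> 1"
      using cases1 by linarith
    have "real (card (S 1)) \<ge> 0" "real (card (S 2)) \<ge> 0" by simp_all
    moreover have "c = 4 \<and> min_spread c = 31/12 \<or> c = 5 \<and> min_spread c = 17/6" using c45 by auto
    \<comment> \<open>Write n1, n2, n3 for the class sizes. For c = 4 the two equations give n1 = n3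
      and the spread 8/3 - n3/12, with n3 \<le> 1. For c = 5 they give n1 = n3 - 2, so n3 \<ge> 2,
      which leaves n1 = 0 and n2 = n3 = 2.\<close>
    ultimately show ?thesis
      unfolding sp using cases2 n s by linarith
  qed
  have large: "min_spread c \<le> (\<Sum>v\<in>K. real (e v) / (1 + real (e v)))" if "k \<ge> 7"
  proof -
    have "min_spread c \<le> 3" using \<open>c \<le> 6\<close> by (cases rule: nat_le6_cases) simp_all
    \<comment> \<open>Discarding the term 2c leaves k/2 - 1/2, which is at least 3 from k = 7
      on.\<close>
    moreover have "(real (2 * c) - real k) / (2 * real k) \<ge> - 1/2"
      using that by (simp add: field_simps)
    ultimately show ?thesis using bound that by linarith
  qed
  have "min_spread c \<le> (\<Sum>v\<in>K. real (e v) / (1 + real (e v)))"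
  proof (cases "k \<ge> 7 \<or> k = 4 \<and> (c = 4 \<or> c = 5)")
    case True
    then show ?thesis using exact large by blast
  next
    case False
    then have "k \<le> 6" "\<not> (k = 4 \<and> (c = 4 \<or> c = 5))" by auto
    from min_spread_small[OF c0 \<open>c \<le> 6\<close> ck this] bound show ?thesis by linarith
  qed
  then show ?thesis using goal_K by (simp add: e_def)
qed

section \<open>Distances and breadth-first parents\<close>

text \<open>Here d is the distance from x, and p v is the last vertex before v on a shortest walk.
  The clause that d grows by at most one along every arc, not only along parent arcs, is what an
  arbitrary spanning tree would not offer.\<close>

lemma (in simple_rel) bfs_tree:
  assumes x: "x \<in> V" and reach: "\<forall>v\<in>V. (x, v) \<in> R\<^sup>*"
  shows "\<exists>(d :: 'a \<Rightarrow> nat) p. (\<forall>v\<in>V. d v = 0 \<longleftrightarrow> v = x) \<and> (\<forall>u v. (u, v) \<in> R \<longrightarrow> d v \<le> Suc (d u)) \<and>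
    (\<forall>v. v \<in> V \<and> v \<noteq> x \<longrightarrow> (v, p v) \<in> R \<and> d v = Suc (d (p v)))"
proof -
  define d where "d v = (LEAST n. (x, v) \<in> R ^^ n)" for v
  have least: "(x, v) \<in> R ^^ d v" if v: "v \<in> V" for v
  proof -
    from reach v obtain n where "(x, v) \<in> R ^^ n" by (auto simp: rtrancl_is_UN_relpow)
    then show ?thesis unfolding d_def by (rule LeastI)
  qed
  have le: "d v \<le> n" if "(x, v) \<in> R ^^ n" for v n
    using that unfolding d_def by (rule Least_le)
  have zero: "d v = 0 \<longleftrightarrow> v = x" if "v \<in> V" for v
    using least[OF that] le[of x 0] by auto
  have step: "d v \<le> Suc (d u)" if "(u, v) \<in> R" for u v
    using that least[of u] in_V[OF that] by (intro le) auto
  have "\<exists>u. (v, u) \<in> R \<and> d v = Suc (d u)" if v: "v \<in> V" "v \<noteq> x" for v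
  proof -
    obtain m where m: "d v = Suc m" using zero[OF v(1)] v(2) not0_implies_Suc by blast
    obtain u where u: "(x, u) \<in> R ^^ m" "(u, v) \<in> R"
      using least[OF v(1)] unfolding m by auto
    have "d v = Suc (d u)" using le[OF u(1)] step[OF u(2)] m by linarith
    then show ?thesis using symmetric_arc[OF u(2)] by blast
  qed
  then have "\<exists>p. \<forall>v. v \<in> V \<and> v \<noteq> x \<longrightarrow> (v, p v) \<in> R \<and> d v = Suc (d (p v))"
    by (intro choice) blast
  moreover have "\<forall>v\<in>V. d v = 0 \<longleftrightarrow> v = x" "\<forall>u v. (u, v) \<in> R \<longrightarrow> d v \<le> Suc (d u)"
    using zero step by simp_all
  ultimately show ?thesis by blast
qed

section \<open>Spanning trees\<close>

text \<open>Distances fall along parent arcs, so these are disjoint from their reverses and T has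
  two arcs per vertex other than x. A neighbour of x is at distance 1, hence its parent is at
  distance 0 and is x itself; so T keeps every edge at x.\<close>

lemma (in simple_rel) spanning_tree:
  assumes x: "x \<in> V" and reach: "\<forall>v\<in>V. (x, v) \<in> R\<^sup>*"
  obtains T where "simple_rel V T" "T \<subseteq> R" "card T = 2 * (card V - 1)"
    "\<forall>v\<in>V. (x, v) \<in> T\<^sup>*" "T `` {x} = R `` {x}"
proof -
  obtain d :: "'a \<Rightarrow> nat" and p where
    d: "\<forall>v\<in>V. d v = 0 \<longleftrightarrow> v = x" "\<forall>u v. (u, v) \<in> R \<longrightarrow> d v \<le> Suc (d u)"
      "\<forall>v. v \<in> V \<and> v \<noteq> x \<longrightarrow> (v, p v) \<in> R \<and> d v = Suc (d (p v))"
    using bfs_tree[OF x reach] by (elim exE conjE)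
  have zero: "d v = 0 \<longleftrightarrow> v = x" if "v \<in> V" for v
    using d(1) that by simp
  have step: "d v \<le> Suc (d u)" if "(u, v) \<in> R" for u v
    using d(2) that by blast
  have par: "(v, p v) \<in> R \<and> d v = Suc (d (p v))" if "v \<in> V" "v \<noteq> x" for v
    using d(3) that by blast
  define A where "A = (\<lambda>v. (v, p v)) ` (V - {x})"
  have A: "(u, v) \<in> A \<longleftrightarrow> u \<in> V \<and> u \<noteq> x \<and> v = p u" for u v
    by (auto simp: A_def)
  have A_R: "A \<subseteq> R" using par unfolding A_def by blast
  have d_A: "d u = Suc (d v)" if "(u, v) \<in> A" for u v
    using that par[of u] by (simp add: A)
  have fin: "finite A" using finite_V by (simp add: A_def)
  have "A \<union> A\<inverse> \<subseteq> R" using A_R symmetric_arc by auto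
  moreover have "simple_rel V (A \<union> A\<inverse>)"
  proof unfold_locales
    show "A \<union> A\<inverse> \<subseteq> V \<times> V" using calculation sub by blast
    show "irrefl (A \<union> A\<inverse>)" using calculation not_self by (auto simp: irrefl_def)
    show "Relation.sym (A \<union> A\<inverse>)" by (auto intro: symI)
  qed (rule finite_V)
  moreover have "card (A \<union> A\<inverse>) = 2 * (card V - 1)"
  proof -
    have "(u, v) \<notin> A\<inverse>" if "(u, v) \<in> A" for u v
      using d_A[OF that] d_A[of v u] by auto
    then have "A \<inter> A\<inverse> = {}" by auto
    then have "card (A \<union> A\<inverse>) = card A + card (A\<inverse>)"
      using fin by (intro card_Un_disjoint) auto
    moreover have "card A = card V - 1"
      unfolding A_def using x finite_V by (subst card_image) (auto intro: inj_onI)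
    ultimately show ?thesis by (simp add: card_inverse)
  qed
  moreover have "(x, v) \<in> (A \<union> A\<inverse>)\<^sup>*" if "v \<in> V" for v
    using that
  proof (induction "d v" arbitrary: v rule: less_induct)
    case less
    show ?case
    proof (cases "v = x")
      case False
      then have "(v, p v) \<in> R" "d v = Suc (d (p v))" using par[OF less.prems] by blast+
      then have "(x, p v) \<in> (A \<union> A\<inverse>)\<^sup>*" using less.hyps[of "p v"] in_V[of v "p v"] by simp
      moreover have "(p v, v) \<in> A \<union> A\<inverse>" using A False less.prems by auto
      ultimately show ?thesis by (rule rtrancl_into_rtrancl)
    qed simp
  qed
  moreover have "(A \<union> A\<inverse>) `` {x} = R `` {x}"
  proof -
    have "(x, v) \<in> A\<inverse>" if "(x, v) \<in> R" for v
    proof -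
      have v: "v \<in> V" "v \<noteq> x" using that in_V not_self by auto
      have "d x = 0" using zero x by simp
      then have "d (p v) = 0" using step[OF that] par[OF v] by simp
      moreover have "p v \<in> V" using par[OF v] in_V by blast
      ultimately have "p v = x" using zero by simp
      then show ?thesis using v A by simp
    qed
    then show ?thesis using calculation(1) by blast
  qed
  ultimately show ?thesis using that by blast
qed

lemma (in simple_rel) degree_pos:
  assumes "card V \<ge> 2" "x \<in> V" "\<forall>v\<in>V. (x, v) \<in> R\<^sup>*" "v \<in> V"
  shows "card (R `` {v}) \<ge> 1"
proof -
  have "\<exists>u. (v, u) \<in> R"
  proof (cases "v = x")
    case True
    have "V \<noteq> {x}" using assms(1) by auto
    then obtain w where "w \<in> V" "w \<noteq> x" using assms(2) by blast
    then show ?thesis using assms(3) True by (metis converse_rtranclE)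
  next
    case False
    then show ?thesis using assms(3,4) symmetric_arc by (metis rtranclE)
  qed
  then have "R `` {v} \<noteq> {}" by blast
  then show ?thesis using finite_nbrs by (simp add: Suc_leI card_gt_0_iff)
qed

text \<open>Moving all edges of a spanning tree to a vertex of maximal degree does not decrease the
  inverse degree, since the summands are convex.\<close>

lemma concentrate_tree_degrees:
  fixes V :: "'a set" and t e :: "'a \<Rightarrow> nat"
  assumes fin: "finite V" and x: "x \<in> V" and n: "card V \<ge> 2"
    and t_pos: "\<forall>v\<in>V. t v \<ge> 1"
    and sum_t: "(\<Sum>v\<in>V. t v) = 2 * (card V - 1)"
    and e_x: "e x = 0"
    and max_x: "\<forall>v\<in>V. e v + t v \<le> t x"
    and t_x: "t x \<le> card V - 1"
  defines "S \<equiv> (\<Sum>v\<in>V. 1 / real (e v + t v))"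
    and "B \<equiv> 1 / (real (card V) - 1) + (\<Sum>v\<in>V - {x}. 1 / (1 + real (e v)))"
  shows "S \<le> B" and "S = B \<Longrightarrow> v \<in> V - {x} \<Longrightarrow> t v = 1"
proof -
  define N where "N = real (card V) - 1"
  define D where "D = real (t x)"
  have pos: "D \<ge> 1" "N \<ge> D" "N \<ge> 1"
    using bspec[OF t_pos x] t_x n by (auto simp: D_def N_def)
  \<comment> \<open>The gain at v is (t v - 1) / ((1 + e v) (e v + t v)), where the factors are at
    most N and D. Since t sums to 2N over V, the bounds (t v - 1) / (N D) add up over v \<noteq> x
    to 1/D - 1/N, exactly what the summand of x loses. If t v > 1 then 1 + e v < e v + t v, which
    makes the estimate strict.\<close>
  have point: "(real (t v) - 1) / (N * D) \<le> 1 / (1 + real (e v)) - 1 / real (e v + t v)"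
      "t v \<noteq> 1 \<Longrightarrow> (real (t v) - 1) / (N * D) < 1 / (1 + real (e v)) - 1 / real (e v + t v)"
    if v: "v \<in> V - {x}" for v
  proof -
    have tv: "t v \<ge> 1" using v t_pos by simp
    have le: "real (e v + t v) \<le> D" using max_x v unfolding D_def by (simp del: of_nat_add)
    have eq: "1 / (1 + real (e v)) - 1 / real (e v + t v) = (real (t v) - 1) / ((1 + real (e v)) * real (e v + t v))"
      using tv by (simp add: field_simps)
    have le1: "1 + real (e v) \<le> N" using le tv pos by simp
    have "(1 + real (e v)) * real (e v + t v) \<le> N * D"
      using le le1 pos by (intro mult_mono) auto
    then show "(real (t v) - 1) / (N * D) \<le> 1 / (1 + real (e v)) - 1 / real (e v + t v)"
      unfolding eq using tv pos by (intro divide_left_mono) auto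
    assume "t v \<noteq> 1"
    then have "1 + real (e v) < N" using le tv pos by simp
    then have "(1 + real (e v)) * real (e v + t v) < N * D"
      using le tv by (intro mult_less_le_imp_less) auto
    then show "(real (t v) - 1) / (N * D) < 1 / (1 + real (e v)) - 1 / real (e v + t v)"
      unfolding eq using tv \<open>t v \<noteq> 1\<close> pos by (intro divide_strict_left_mono) auto
  qed
  have "(\<Sum>v\<in>V. real (t v)) = 2 * N"
    using sum_t n unfolding N_def by (simp add: of_nat_diff flip: of_nat_sum)
  then have "(\<Sum>v\<in>V - {x}. real (t v)) = 2 * N - D"
    using fin x by (simp add: sum_diff1 D_def)
  then have "(\<Sum>v\<in>V - {x}. (real (t v) - 1) / (N * D)) = (N - D) / (N * D)"
    using fin x n by (simp add: sum_subtractf N_def of_nat_diff algebra_simps flip: sum_divide_distrib)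
  also have "\<dots> = 1 / D - 1 / N" using pos by (simp add: field_simps)
  finally have low: "(\<Sum>v\<in>V - {x}. (real (t v) - 1) / (N * D)) = 1 / D - 1 / N" .
  have diff: "B - S = (\<Sum>v\<in>V - {x}. 1 / (1 + real (e v)) - 1 / real (e v + t v)) - (1 / D - 1 / N)"
    unfolding S_def B_def using sum.remove[OF fin x, of "\<lambda>v. 1 / real (e v + t v)"] e_x
    by (simp add: sum_subtractf N_def D_def)
  have "1 / D - 1 / N \<le> (\<Sum>v\<in>V - {x}. 1 / (1 + real (e v)) - 1 / real (e v + t v))"
    unfolding low[symmetric] by (rule sum_mono) (use point in blast)
  then show "S \<le> B" using diff by linarith
  show "t v = 1" if "S = B" "v \<in> V - {x}"
  proof (rule ccontr)
    assume "t v \<noteq> 1"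
    then have "1 / D - 1 / N < (\<Sum>v\<in>V - {x}. 1 / (1 + real (e v)) - 1 / real (e v + t v))"
      unfolding low[symmetric] using fin point that(2)
      by (intro sum_strict_mono_ex1) blast+
    then show False using diff that(1) by linarith
  qed
qed

section \<open>Paths from degree bounds\<close>

text \<open>The distance from x is itself the numbering. A vertex other than x spends one of its two
  edges on its parent, and x has only one edge, so each vertex has at most one neighbour further
  out, and by induction no distance occurs twice. The bound at x is what rules out a cycle.\<close>

lemma (in simple_rel) path_order:
  assumes x: "x \<in> V" and reach: "\<forall>v\<in>V. (x, v) \<in> R\<^sup>*"
    and deg_x: "card (R `` {x}) \<le> 1" and deg: "\<forall>v\<in>V. card (R `` {v}) \<le> 2"
  shows "\<exists>f. bij_betw f V {..<card V} \<and> f x = 0 \<and>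
    (\<forall>a\<in>V. \<forall>b\<in>V. (a, b) \<in> R \<longleftrightarrow> f a = Suc (f b) \<or> f b = Suc (f a))"
proof -
  obtain d :: "'a \<Rightarrow> nat" and p where
    d: "\<forall>v\<in>V. d v = 0 \<longleftrightarrow> v = x" "\<forall>u v. (u, v) \<in> R \<longrightarrow> d v \<le> Suc (d u)"
      "\<forall>v. v \<in> V \<and> v \<noteq> x \<longrightarrow> (v, p v) \<in> R \<and> d v = Suc (d (p v))"
    using bfs_tree[OF x reach] by (elim exE conjE)
  have zero: "d v = 0 \<longleftrightarrow> v = x" if "v \<in> V" for v
    using d(1) that by simp
  have step: "d v \<le> Suc (d u)" if "(u, v) \<in> R" for u v
    using d(2) that by blast
  have par: "(v, p v) \<in> R \<and> d v = Suc (d (p v))" if "v \<in> V" "v \<noteq> x" for v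
    using d(3) that by blast
  have succ_unique: "a = b" if "(q, a) \<in> R" "(q, b) \<in> R" "d a = Suc (d q)" "d b = Suc (d q)" for a b q
  proof (rule ccontr)
    assume "a \<noteq> b"
    have q: "q \<in> V" using that in_V by blast
    show False
    proof (cases "q = x")
      case True
      have "card {a, b} \<le> card (R `` {x})"
        using that True by (intro card_mono finite_nbrs) auto
      then show False using deg_x \<open>a \<noteq> b\<close> by simp
    next
      case False
      note pq = par[OF q False]
      have "card {a, b, p q} \<le> card (R `` {q})"
        using that pq by (intro card_mono finite_nbrs) auto
      moreover have "p q \<noteq> a" "p q \<noteq> b" using that pq by auto
      ultimately show False using bspec[OF deg q] \<open>a \<noteq> b\<close> by simp
    qed
  qed
  have uniq: "a \<in> V \<Longrightarrow> b \<in> V \<Longrightarrow> d a = m \<Longrightarrow> d b = m \<Longrightarrow> a = b" for a b m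
  proof (induction m arbitrary: a b)
    case 0
    then show ?case using zero by blast
  next
    case (Suc m)
    then have nx: "a \<noteq> x" "b \<noteq> x" using zero[OF x] by auto
    note pa = par[OF Suc.prems(1) nx(1)] and pb = par[OF Suc.prems(2) nx(2)]
    have "p a = p b" using Suc pa pb in_V by (metis nat.inject)
    then show ?case using succ_unique[of "p a" a b] pa pb symmetric_arc by simp
  qed
  have inj: "inj_on d V" using uniq by (blast intro: inj_onI)
  \<comment> \<open>Following parents meets every smaller distance, so the distances fill an initial
    segment.\<close>
  have down: "\<exists>u\<in>V. d u = m" if "v \<in> V" "m \<le> d v" for v m
    using that
  proof (induction "d v" arbitrary: v)
    case 0
    then show ?case by auto
  next
    case (Suc k)
    show ?case
    proof (cases "m = d v")
      case False
      have "v \<noteq> x" using Suc.hyps(2) zero[OF x] by auto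
      then have "p v \<in> V" "d v = Suc (d (p v))" using par[OF Suc.prems(1)] in_V by blast+
      then show ?thesis using Suc.hyps False Suc.prems by auto
    qed (use Suc in blast)
  qed
  define M where "M = Max (d ` V)"
  have fin: "finite (d ` V)" using finite_V by simp
  have "M \<in> d ` V" unfolding M_def using fin x by (intro Max_in) auto
  then obtain v where "v \<in> V" "d v = M" by blast
  then have "d ` V = {..M}"
    using down[of v] Max_ge[OF fin] unfolding M_def[symmetric] by force
  moreover from this have "card V = Suc M" using card_image[OF inj] by simp
  ultimately have bij: "bij_betw d V {..<card V}"
    using inj by (simp add: bij_betw_def lessThan_Suc_atMost)
  have adj_pred: "(b, a) \<in> R" if "a \<in> V" "b \<in> V" "d b = Suc (d a)" for a b
  proof -
    have "b \<noteq> x" using that zero by fastforce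
    note pb = par[OF that(2) this]
    have "p b = a" using pb that uniq[of "p b" a "d a"] in_V by auto
    then show ?thesis using pb by simp
  qed
  have "(a, b) \<in> R \<longleftrightarrow> d a = Suc (d b) \<or> d b = Suc (d a)" if "a \<in> V" "b \<in> V" for a b
  proof
    assume ab: "(a, b) \<in> R"
    have "d a \<noteq> d b" using uniq that ab not_self by metis
    then show "d a = Suc (d b) \<or> d b = Suc (d a)"
      using step[OF ab] step[OF symmetric_arc[OF ab]] by linarith
  qed (use adj_pred[OF that] adj_pred[OF that(2,1)] symmetric_arc in blast)
  moreover have "d x = 0" using zero x by simp
  ultimately show ?thesis using bij by (intro exI[of _ d]) simp
qed

section \<open>Pair graphs, isomorphisms and convexity of the reciprocal\<close>

lemma degree_conv_card: "degree G v = card (parcs G `` {v})"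
proof -
  have "out_arcs (with_proj G) v = Pair v ` (parcs G `` {v})"
    by (auto simp: out_arcs_def)
  then show ?thesis by (simp add: out_degree_def card_image inj_on_def)
qed

lemma pair_graph_iff_simple_rel: "pair_graph G \<longleftrightarrow> simple_rel (pverts G) (parcs G)"
proof
  assume "pair_graph G"
  then interpret pair_graph G .
  show "simple_rel (pverts G) (parcs G)"
  proof
    show "parcs G \<subseteq> pverts G \<times> pverts G" using in_arcsD1 in_arcsD2 by auto
    show "Relation.sym (parcs G)" using arcs_symmetric by (auto intro: symI)
    show "irrefl (parcs G)" using pair_no_loops by (fastforce simp: irrefl_def)
  qed (rule pair_finite_verts)
next
  assume "simple_rel (pverts G) (parcs G)"
  then interpret simple_rel "pverts G" "parcs G" .
  show "pair_graph G"
  proof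
    show "fst e \<in> pverts G" "snd e \<in> pverts G" if "e \<in> parcs G" for e
      using that sub by auto
    show "fst e \<noteq> snd e" if "e \<in> parcs G" for e
      using that not_self by (cases e) auto
    show "symmetric (with_proj G)" using sym by (simp add: symmetric_def)
  qed (use finite_V finite_R in auto)
qed

text \<open>R counts every edge twice, so m = n + c - 1 becomes an equation between natural numbers
  without truncated subtraction. Connectedness is stated from every start vertex, ready for
  whichever root an argument chooses.\<close>

locale cyclic_rel = simple_rel +
  fixes c :: nat
  assumes conn: "\<And>x. x \<in> V \<Longrightarrow> \<forall>v\<in>V. (x, v) \<in> R\<^sup>*"
    and nonempty: "V \<noteq> {}"
    and card_R: "card R + 2 = 2 * (card V + c)"

text \<open>In the library, \<open>connected\<close> means strong connectedness of the symmetric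
  closure, with reachability relative to the vertex set. For a pair graph the closure changes
  nothing and every arc stays inside the vertex set, so the plain reflexive transitive closure
  suffices.\<close>

lemma c_cyclic_iff: "c_cyclic c G \<longleftrightarrow> cyclic_rel (pverts G) (parcs G) c"
proof (cases "pair_graph G")
  case False
  then show ?thesis
    by (simp add: c_cyclic_def cyclic_rel_def pair_graph_iff_simple_rel)
next
  case True
  then interpret pair_graph G .
  interpret S: simple_rel "pverts G" "parcs G"
    using True by (simp add: pair_graph_iff_simple_rel)
  have mk: "parcs (mk_symmetric (with_proj G)) = parcs G"
    using adj_mk_symmetric_eq[OF sym_arcs] by simp
  have "(u, v) \<in> rtrancl_on (pverts G) (parcs G) \<longleftrightarrow> (u, v) \<in> (parcs G)\<^sup>*"
    if "u \<in> pverts G" "v \<in> pverts G" for u v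
    using that S.in_V rtrancl_on_rtranclI rtrancl_consistent_rtrancl_on by metis
  then have conn: "connected (with_proj G) \<longleftrightarrow> pverts G \<noteq> {} \<and> (\<forall>x\<in>pverts G. \<forall>v\<in>pverts G. (x, v) \<in> (parcs G)\<^sup>*)"
    by (simp add: connected_def strongly_connected_def reachable_def mk)
  have "int c = int m - int n + 1 \<longleftrightarrow> a + 2 = 2 * (n + c)" if "a = 2 * m" for a m n :: nat
    using that by presburger
  moreover have "card (parcs G) = 2 * card (edges G)"
    using S.card_eq_twice_edges by (simp add: edges_def)
  ultimately have "int c = int (card (edges G)) - int (card (pverts G)) + 1
      \<longleftrightarrow> card (parcs G) + 2 = 2 * (card (pverts G) + c)"
    by blast
  then show ?thesis
    using True S.simple_rel_axioms
    by (auto simp: c_cyclic_def cyclic_rel_def cyclic_rel_axioms_def conn)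
qed

lemma isomorphicI:
  assumes "pair_graph G" and bij: "bij_betw f (pverts G) (pverts H)"
    and sub: "parcs H \<subseteq> pverts H \<times> pverts H"
    and adj: "\<And>a b. a \<in> pverts G \<Longrightarrow> b \<in> pverts G \<Longrightarrow> (f a, f b) \<in> parcs H \<longleftrightarrow> (a, b) \<in> parcs G"
  shows "isomorphic G H"
proof -
  interpret pair_graph G by fact
  \<comment> \<open>An isomorphism of digraphs also acts on arcs and on the two projections; for
    pairs the arc map must apply f to both components.\<close>
  define hom where "hom = \<lparr> iso_verts = f, iso_arcs = map_prod f f, iso_head = snd, iso_tail = fst \<rparr>"
  have inj: "inj_on f (pverts G)" and img: "f ` pverts G = pverts H"
    using bij by (auto simp: bij_betw_def)
  have "inj_on (map_prod f f) (parcs G)"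
    by (rule inj_on_subset[OF map_prod_inj_on[OF inj inj]]) (use in_arcsD1 in_arcsD2 in auto)
  then have "digraph_isomorphism hom"
    using inj wf_digraph_axioms by (auto simp: digraph_isomorphism_def hom_def)
  moreover have "parcs H = map_prod f f ` parcs G"
  proof (intro equalityI subsetI)
    fix e assume e: "e \<in> parcs H"
    obtain i j where ij: "e = (i, j)" by (cases e)
    with e sub img obtain a b where "a \<in> pverts G" "b \<in> pverts G" "i = f a" "j = f b" by blast
    then show "e \<in> map_prod f f ` parcs G" using adj e ij by force
  next
    fix e assume "e \<in> map_prod f f ` parcs G"
    then show "e \<in> parcs H" using adj in_arcsD1 in_arcsD2 by auto
  qed
  then have "with_proj H = app_iso hom (with_proj G)"
    using img by (simp add: app_iso_def hom_def with_proj_def)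
  ultimately show ?thesis by (auto simp: digraph_iso_def)
qed

text \<open>Among trees, or among unicyclic graphs, the extremal graphs are recognised by a bound on
  all degrees or by one large degree, so the set of degrees is a sufficient invariant.\<close>

lemma isomorphic_degree_set:
  assumes "pair_graph G" "isomorphic G H"
  shows "(\<lambda>v. card (parcs G `` {v})) ` pverts G = (\<lambda>w. card (parcs H `` {w})) ` pverts H"
proof -
  interpret pair_graph G by fact
  from assms(2) obtain hom where hom: "digraph_isomorphism hom" and H: "with_proj H = app_iso hom (with_proj G)"
    by (auto simp: digraph_iso_def)
  define f where "f = iso_verts hom"
  have inj: "inj_on f (pverts G)"
    using hom by (simp add: digraph_isomorphism_def f_def)
  have V: "pverts H = f ` pverts G"
    using arg_cong[OF H, of verts] by (simp add: f_def)
  have E: "parcs H = iso_arcs hom ` parcs G"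
    using arg_cong[OF H, of arcs] by simp
  \<comment> \<open>\<open>with_proj H\<close> has \<open>fst\<close> and \<open>snd\<close> as its
    projections, so the equation for H fixes the new projections and with them the arc map.\<close>
  have "fst = iso_tail hom" "snd = iso_head hom"
    using arg_cong[OF H, of tail] arg_cong[OF H, of head] by simp_all
  then have "iso_arcs hom e = map_prod f f e" if "e \<in> parcs G" for e
    using hom that by (intro prod_eqI) (auto simp: digraph_isomorphism_def f_def)
  then have E': "parcs H = map_prod f f ` parcs G" unfolding E by (rule image_cong[OF refl])
  have "card (parcs H `` {f v}) = card (parcs G `` {v})" if v: "v \<in> pverts G" for v
  proof -
    have "parcs H `` {f v} = f ` (parcs G `` {v})"
    proof (intro equalityI subsetI)
      fix w assume "w \<in> parcs H `` {f v}"
      then obtain a b where ab: "(a, b) \<in> parcs G" "f v = f a" "w = f b" unfolding E' by auto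
      then have "v = a" using inj_onD[OF inj] v in_arcsD1 by blast
      then show "w \<in> f ` (parcs G `` {v})" using ab by blast
    next
      fix w assume "w \<in> f ` (parcs G `` {v})"
      then show "w \<in> parcs H `` {f v}" unfolding E' by force
    qed
    moreover have "inj_on f (parcs G `` {v})"
      using inj in_arcsD2 by (blast intro: inj_on_subset)
    ultimately show ?thesis by (simp add: card_image)
  qed
  then show ?thesis unfolding V image_image by (intro image_cong) simp_all
qed

section \<open>The chord bound for reciprocals\<close>

text \<open>The left-hand side is the chord of 1/x through k and k + 1. The difference has the
  numerator (d - k)(d - k - 1), a product of consecutive integers, hence nonnegative and zero only
  at the two ends.\<close>

lemma inverse_ge_chord:
  fixes d k :: nat
  assumes "d \<ge> 1" "k \<ge> 1"
  shows "(2 * real k + 1 - real d) / (real k * (real k + 1)) \<le> 1 / real d"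
    and "(2 * real k + 1 - real d) / (real k * (real k + 1)) = 1 / real d \<longleftrightarrow> d = k \<or> d = Suc k"
proof -
  have pos: "real k * (real k + 1) * real d > 0" using assms by simp
  have eq: "1 / real d - (2 * real k + 1 - real d) / (real k * (real k + 1))
      = (real d - real k) * (real d - real k - 1) / (real k * (real k + 1) * real d)"
  proof -
    have "1 / D - (2 * K + 1 - D) / (K * (K + 1)) = (D - K) * (D - K - 1) / (K * (K + 1) * D)"
      if "D > 0" "K > 0" for D K :: real
      using that by (simp add: divide_simps) (simp add: algebra_simps)
    then show ?thesis using assms by simp
  qed
  have "(real d - real k) * (real d - real k - 1) \<ge> 0"
    by (cases "d \<le> k") (auto intro: mult_nonpos_nonpos mult_nonneg_nonneg)
  then have "1 / real d - (2 * real k + 1 - real d) / (real k * (real k + 1)) \<ge> 0"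
    unfolding eq using pos by simp
  then show "(2 * real k + 1 - real d) / (real k * (real k + 1)) \<le> 1 / real d" by simp
  have "(2 * real k + 1 - real d) / (real k * (real k + 1)) = 1 / real d
      \<longleftrightarrow> (real d - real k) * (real d - real k - 1) / (real k * (real k + 1) * real d) = 0"
    unfolding eq[symmetric] by linarith
  also have "\<dots> \<longleftrightarrow> real d = real k \<or> real d = real (Suc k)" using pos by auto
  finally show "(2 * real k + 1 - real d) / (real k * (real k + 1)) = 1 / real d \<longleftrightarrow> d = k \<or> d = Suc k"
    by (simp only: of_nat_eq_iff)
qed

text \<open>Summing a linear function of the degrees leaves only their number and their sum, which c
  determines. The equality case serves both ways: to characterise extremal graphs, and to evaluate
  the sum when all degrees are k or k + 1.\<close>

lemma sum_inverse_ge_chord: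
  fixes d :: "'a \<Rightarrow> nat"
  assumes "finite A" and d: "\<And>v. v \<in> A \<Longrightarrow> d v \<ge> 1" and k: "k \<ge> 1"
  shows "((2 * real k + 1) * real (card A) - real (sum d A)) / (real k * (real k + 1)) \<le> (\<Sum>v\<in>A. 1 / real (d v))"
    and "(\<Sum>v\<in>A. 1 / real (d v)) = ((2 * real k + 1) * real (card A) - real (sum d A)) / (real k * (real k + 1))
      \<longleftrightarrow> (\<forall>v\<in>A. d v = k \<or> d v = Suc k)"
proof -
  let ?g = "\<lambda>v. (2 * real k + 1 - real (d v)) / (real k * (real k + 1))"
  have eq: "((2 * real k + 1) * real (card A) - real (sum d A)) / (real k * (real k + 1)) = sum ?g A"
    by (simp add: sum_subtractf flip: sum_divide_distrib)
  have le: "?g v \<le> 1 / real (d v)" if "v \<in> A" for v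
    using inverse_ge_chord(1)[OF d[OF that] k] .
  show "((2 * real k + 1) * real (card A) - real (sum d A)) / (real k * (real k + 1)) \<le> (\<Sum>v\<in>A. 1 / real (d v))"
    unfolding eq by (rule sum_mono) (rule le)
  have "(\<Sum>v\<in>A. 1 / real (d v)) = sum ?g A \<longleftrightarrow> (\<Sum>v\<in>A. 1 / real (d v) - ?g v) = 0"
    by (simp add: sum_subtractf)
  also have "\<dots> \<longleftrightarrow> (\<forall>v\<in>A. 1 / real (d v) - ?g v = 0)"
    using le \<open>finite A\<close> by (intro sum_nonneg_eq_0_iff) auto
  also have "\<dots> \<longleftrightarrow> (\<forall>v\<in>A. d v = k \<or> d v = Suc k)"
  proof (intro ball_cong refl)
    fix v assume "v \<in> A"
    then show "1 / real (d v) - ?g v = 0 \<longleftrightarrow> d v = k \<or> d v = Suc k"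
      using inverse_ge_chord(2)[OF d k, of v] by auto
  qed
  finally show "(\<Sum>v\<in>A. 1 / real (d v)) = ((2 * real k + 1) * real (card A) - real (sum d A)) / (real k * (real k + 1))
      \<longleftrightarrow> (\<forall>v\<in>A. d v = k \<or> d v = Suc k)"
    unfolding eq .
qed

lemma (in simple_rel) two_arcs:
  assumes "card R = 2"
  obtains u v where "u \<noteq> v" "R = {(u, v), (v, u)}"
proof -
  have "R \<noteq> {}" using assms by auto
  then obtain u v where uv: "(u, v) \<in> R" by auto
  have "u \<noteq> v" using uv not_self by blast
  have "{(u, v), (v, u)} = R"
    using uv symmetric_arc[OF uv] assms finite_R \<open>u \<noteq> v\<close> by (intro card_subset_eq) auto
  then show ?thesis using that \<open>u \<noteq> v\<close> by blast
qed

text \<open>For the stars only the centre, or the centre and the ends of the extra edge, need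
  prescribed numbers; the other vertices are interchangeable.\<close>

lemma numbering_extending:
  assumes "finite V" "distinct xs" "set xs \<subseteq> V"
  obtains f where "bij_betw f V {..<card V}" "\<And>i. i < length xs \<Longrightarrow> f (xs ! i) = i"
proof -
  obtain ys where ys: "set ys = V - set xs" "distinct ys"
    using finite_distinct_list assms(1) by (meson finite_Diff)
  define zs where "zs = xs @ ys"
  have zs: "distinct zs" "set zs = V" using ys assms by (auto simp: zs_def)
  then have bij: "bij_betw ((!) zs) {..<card V} V"
    by (intro bij_betw_nth) (auto simp: distinct_card)
  define f where "f = inv_into {..<card V} ((!) zs)"
  have "f (xs ! i) = i" if "i < length xs" for i
  proof -
    have "length xs \<le> card V" using assms distinct_card[OF assms(2)] by (metis card_mono)
    then have "i \<in> {..<card V}" using that by simp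
    moreover have "zs ! i = xs ! i" using that by (simp add: zs_def nth_append)
    ultimately show ?thesis
      unfolding f_def using inv_into_f_f[OF bij_betw_imp_inj_on[OF bij]] by metis
  qed
  then show ?thesis using that bij_betw_inv_into[OF bij] unfolding f_def by blast
qed

section \<open>Bounds for connected graphs with cyclomatic number c\<close>

context cyclic_rel
begin

abbreviation deg :: "'a \<Rightarrow> nat" where
  "deg v \<equiv> card (R `` {v})"

definition rho :: real where
  "rho = (\<Sum>v\<in>V. 1 / real (deg v))"

lemma sum_deg: "real (\<Sum>v\<in>V. deg v) = 2 * (real (card V) + real c) - 2"
proof -
  have "real (card R) + 2 = 2 * (real (card V) + real c)"
    using arg_cong[OF card_R, of real] by simp
  then show ?thesis unfolding sum_degrees by simp
qed

lemma deg_pos: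
  assumes "card V \<ge> 2" "v \<in> V"
  shows "deg v \<ge> 1"
  using degree_pos[OF assms conn[OF assms(2)] assms(2)] .

section \<open>Lower bounds and their equality cases\<close>

text \<open>The average degree 2 - 2/n of a tree lies between 1 and 2, hence the chord with k =
  1.\<close>

lemma rho_lower_tree:
  assumes "c = 0" "card V \<ge> 2"
  shows "(real (card V) + 2) / 2 \<le> rho"
    and "rho = (real (card V) + 2) / 2 \<longleftrightarrow> (\<forall>v\<in>V. deg v \<le> 2)"
proof -
  note chord = sum_inverse_ge_chord[where A = V and d = deg and k = 1, OF finite_V]
  have eq: "((2 * real 1 + 1) * real (card V) - real (\<Sum>v\<in>V. deg v)) / (real 1 * (real 1 + 1))
      = (real (card V) + 2) / 2"
    unfolding sum_deg using assms by simp
  show "(real (card V) + 2) / 2 \<le> rho"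
    using chord(1) deg_pos[OF assms(2)] unfolding eq rho_def by simp
  have "rho = (real (card V) + 2) / 2 \<longleftrightarrow> (\<forall>v\<in>V. deg v = 1 \<or> deg v = Suc 1)"
    using chord(2) deg_pos[OF assms(2)] unfolding eq rho_def by simp
  also have "\<dots> \<longleftrightarrow> (\<forall>v\<in>V. deg v \<le> 2)"
  proof (intro ball_cong refl)
    fix v assume "v \<in> V"
    then show "deg v = 1 \<or> deg v = Suc 1 \<longleftrightarrow> deg v \<le> 2"
      using deg_pos[OF assms(2), of v] by linarith
  qed
  finally show "rho = (real (card V) + 2) / 2 \<longleftrightarrow> (\<forall>v\<in>V. deg v \<le> 2)" .
qed

text \<open>For degree sum 2n + 2c - 2 the chord through 2 and 3 yields (5n - (2n + 2c - 2))/6. In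
  the equality case the sum leaves exactly 2(c - 1) vertices of degree 3, which explains the minimal
  sequences in the theorem.\<close>

lemma rho_lower:
  assumes "card V \<ge> 2"
  shows "real (card V) / 2 - (real c - 1) / 3 \<le> rho"
    and "rho = real (card V) / 2 - (real c - 1) / 3 \<longleftrightarrow> (\<forall>v\<in>V. deg v = 2 \<or> deg v = 3)"
proof -
  note chord = sum_inverse_ge_chord[where A = V and d = deg and k = 2, OF finite_V]
  have eq: "((2 * real 2 + 1) * real (card V) - real (\<Sum>v\<in>V. deg v)) / (real 2 * (real 2 + 1))
      = real (card V) / 2 - (real c - 1) / 3"
    unfolding sum_deg by (simp add: field_simps)
  show "real (card V) / 2 - (real c - 1) / 3 \<le> rho"
    using chord(1) deg_pos[OF assms] unfolding eq rho_def by simp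
  show "rho = real (card V) / 2 - (real c - 1) / 3 \<longleftrightarrow> (\<forall>v\<in>V. deg v = 2 \<or> deg v = 3)"
    using chord(2) deg_pos[OF assms] unfolding eq rho_def by simp
qed

text \<open>The average degree is exactly 2, so a bound from either side is an equality everywhere.
  The bound from above arises in the comparison with a cycle, the one from below from the chord
  through 2 and 3.\<close>

lemma unicyclic_all_deg_two:
  assumes "c = 1" "(\<forall>v\<in>V. deg v \<le> 2) \<or> (\<forall>v\<in>V. deg v \<ge> 2)"
  shows "\<forall>v\<in>V. deg v = 2"
proof -
  have sum: "(\<Sum>v\<in>V. deg v) = (\<Sum>v\<in>V. 2)"
    using sum_degrees card_R assms(1) by simp
  from assms(2) show ?thesis
  proof
    assume le: "\<forall>v\<in>V. deg v \<le> 2"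
    show ?thesis using sum_mono_inv[OF sum] le finite_V by blast
  next
    assume ge: "\<forall>v\<in>V. deg v \<ge> 2"
    show ?thesis using sum_mono_inv[OF sum[symmetric]] ge finite_V by metis
  qed
qed

lemma rho_lower_unicyclic:
  assumes "c = 1" "card V \<ge> 2"
  shows "rho = real (card V) / 2 \<longleftrightarrow> (\<forall>v\<in>V. deg v \<le> 2)"
proof -
  have "rho = real (card V) / 2 \<longleftrightarrow> (\<forall>v\<in>V. deg v = 2 \<or> deg v = 3)"
    using rho_lower(2) assms by simp
  also have "\<dots> \<longleftrightarrow> (\<forall>v\<in>V. deg v \<le> 2)"
    using unicyclic_all_deg_two[OF assms(1)] by fastforce
  finally show ?thesis .
qed

text \<open>Some vertex has degree at most 1, since otherwise the degree sum 2n - 2 would be at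
  least 2n; the numbering starts there.\<close>

lemma tree_path_order:
  assumes "c = 0" "card V \<ge> 2" "\<forall>v\<in>V. deg v \<le> 2"
  shows "\<exists>f. bij_betw f V {..<card V} \<and>
    (\<forall>a\<in>V. \<forall>b\<in>V. (a, b) \<in> R \<longleftrightarrow> f a = Suc (f b) \<or> f b = Suc (f a))"
proof -
  have "\<exists>x\<in>V. deg x \<le> 1"
  proof (rule ccontr)
    assume "\<not> (\<exists>x\<in>V. deg x \<le> 1)"
    then have "(\<Sum>v\<in>V. 2) \<le> (\<Sum>v\<in>V. deg v)" by (intro sum_mono) force
    then show False using sum_degrees card_R assms by simp
  qed
  then obtain x where x: "x \<in> V" "deg x \<le> 1" by blast
  then show ?thesis using path_order[OF x(1) conn[OF x(1)] x(2) assms(3)] by (elim ex_forward) simp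
qed

text \<open>Removing the one edge uv outside a spanning tree T leaves degrees at most 2, and at most
  1 at u and v. Distances in T from u number it as a path, v must be its other end, and uv closes
  the cycle.\<close>

lemma unicyclic_cycle_order:
  assumes "c = 1" "card V \<ge> 3" "\<forall>v\<in>V. deg v = 2"
  shows "\<exists>f. bij_betw f V {..<card V} \<and>
    (\<forall>a\<in>V. \<forall>b\<in>V. (a, b) \<in> R \<longleftrightarrow> f a = Suc (f b) \<or> f b = Suc (f a)
      \<or> f a = 0 \<and> f b = card V - 1 \<or> f b = 0 \<and> f a = card V - 1)"
proof -
  obtain x where x: "x \<in> V" using nonempty by blast
  obtain T where T: "simple_rel V T" "T \<subseteq> R" "card T = 2 * (card V - 1)" "\<forall>v\<in>V. (x, v) \<in> T\<^sup>*"
    by (rule spanning_tree[OF x conn[OF x]])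
  interpret T: simple_rel V T by (rule T(1))
  interpret H: simple_rel V "R - T"
    using finite_V sub symmetric_arc T.symmetric_arc not_self
    by unfold_locales (auto simp: irrefl_def intro!: symI)
  have "card (R - T) = 2"
    using card_Diff_subset[OF T.finite_R T(2)] T(3) card_R assms by simp
  then obtain u v where uv: "u \<noteq> v" "R - T = {(u, v), (v, u)}" by (rule H.two_arcs)
  then have in_R: "(u, v) \<in> R" "(v, u) \<in> R" "(u, v) \<notin> T" "(v, u) \<notin> T" by auto
  then have V: "u \<in> V" "v \<in> V" using in_V by auto
  have T_le: "\<forall>w\<in>V. card (T `` {w}) \<le> 2"
  proof
    fix w assume "w \<in> V"
    moreover have "card (T `` {w}) \<le> card (R `` {w})" using T(2) by (intro card_mono finite_nbrs) blast
    ultimately show "card (T `` {w}) \<le> 2" using assms(3) by simp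
  qed
  have T_less: "card (T `` {w}) \<le> 1" if "w \<in> V" "(w, y) \<in> R" "(w, y) \<notin> T" for w y
  proof -
    have "T `` {w} \<subset> R `` {w}" using T(2) that by blast
    then have "card (T `` {w}) < card (R `` {w})" by (rule psubset_card_mono[OF finite_nbrs])
    then show ?thesis using assms(3) that(1) by simp
  qed
  have "(u, x) \<in> T\<^sup>*" using T(4) V sym_rtrancl[OF T.sym] by (blast dest: symD)
  then have reach: "\<forall>w\<in>V. (u, w) \<in> T\<^sup>*" using T(4) by (blast intro: rtrancl_trans)
  obtain f where f: "bij_betw f V {..<card V}" "f u = 0"
      "\<forall>a\<in>V. \<forall>b\<in>V. (a, b) \<in> T \<longleftrightarrow> f a = Suc (f b) \<or> f b = Suc (f a)"
    using T.path_order[OF V(1) reach T_less[OF V(1) in_R(1,3)] T_le] by (elim exE conjE)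
  have inj: "a = b" if "a \<in> V" "b \<in> V" "f a = f b" for a b
    using f(1) that by (auto simp: bij_betw_def dest: inj_onD)
  have onto: "\<exists>a\<in>V. f a = i" if "i < card V" for i
    using f(1) that by (auto simp: bij_betw_def image_iff dest: equalityD2)
  have less: "f a < card V" if "a \<in> V" for a
    using f(1) that by (auto simp: bij_betw_def)
  \<comment> \<open>At an inner position v would have both a predecessor and a successor in
    T.\<close>
  have f_v: "f v = card V - 1"
  proof (rule ccontr)
    assume "f v \<noteq> card V - 1"
    then have "Suc (f v) < card V" using less[OF V(2)] by linarith
    then obtain b where b: "b \<in> V" "f b = Suc (f v)" using onto by blast
    have nz: "f v \<noteq> 0" using inj[OF V] f(2) uv(1) by auto
    have "f v - 1 < card V" using less[OF V(2)] by linarith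
    then obtain a where a: "a \<in> V" "f a = f v - 1" using onto by blast
    have "(v, a) \<in> T" using f(3) V(2) a nz by simp
    moreover have "(v, b) \<in> T" using f(3) V(2) b by simp
    ultimately have "card {a, b} \<le> card (T `` {v})"
      by (intro card_mono T.finite_nbrs) auto
    moreover have "a \<noteq> b" using a(2) b(2) nz by auto
    ultimately show False using T_less[OF V(2) in_R(2,4)] by simp
  qed
  have "(a, b) \<in> R \<longleftrightarrow> f a = Suc (f b) \<or> f b = Suc (f a)
      \<or> f a = 0 \<and> f b = card V - 1 \<or> f b = 0 \<and> f a = card V - 1" if ab: "a \<in> V" "b \<in> V" for a b
  proof -
    have "R = T \<union> {(u, v), (v, u)}" using uv(2) T(2) by blast
    then have "(a, b) \<in> R \<longleftrightarrow> (a, b) \<in> T \<or> a = u \<and> b = v \<or> a = v \<and> b = u"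
      by auto
    moreover have "a = u \<longleftrightarrow> f a = 0" "b = u \<longleftrightarrow> f b = 0"
      using inj[OF _ V(1)] ab f(2) by auto
    moreover have "a = v \<longleftrightarrow> f a = card V - 1" "b = v \<longleftrightarrow> f b = card V - 1"
      using inj[OF _ V(2)] ab f_v by auto
    moreover have "(a, b) \<in> T \<longleftrightarrow> f a = Suc (f b) \<or> f b = Suc (f a)"
      using f(3) ab by simp
    ultimately show ?thesis by argo
  qed
  then show ?thesis using f(1) by (intro exI[of _ f]) simp
qed

section \<open>The upper bound and its equality case\<close>

text \<open>In the case of equality the tree is a star: t v = 1 off x, and the degree sum 2(n - 1)
  of the tree leaves n - 1 for x.\<close>

lemma rho_upper:
  assumes "card V \<ge> 2" "c \<le> 6"
  defines "B \<equiv> 1 / (real (card V) - 1) + (real (card V) - 1) - min_spread c"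
  shows "rho \<le> B" and "rho = B \<Longrightarrow> \<exists>x\<in>V. deg x = card V - 1"
proof -
  have "finite (deg ` V)" "deg ` V \<noteq> {}" using finite_V nonempty by auto
  then have "Max (deg ` V) \<in> deg ` V" by (rule Max_in)
  then obtain x where x: "x \<in> V" "deg x = Max (deg ` V)" by force
  then have max: "deg v \<le> deg x" if "v \<in> V" for v
    using finite_V that by simp
  obtain T where T: "simple_rel V T" "T \<subseteq> R" "card T = 2 * (card V - 1)" "\<forall>v\<in>V. (x, v) \<in> T\<^sup>*"
      "T `` {x} = R `` {x}"
    by (rule spanning_tree[OF x(1) conn[OF x(1)]])
  interpret T: simple_rel V T by (rule T(1))
  interpret H: simple_rel V "R - T"
    using finite_V sub symmetric_arc T.symmetric_arc not_self
    by unfold_locales (auto simp: irrefl_def intro!: symI)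
  define e where "e v = card ((R - T) `` {v})" for v
  define t where "t v = card (T `` {v})" for v
  have card_H: "card (R - T) = 2 * c"
    using card_Diff_subset[OF T.finite_R T(2)] T(3) card_R assms(1) by simp
  have split: "e v + t v = deg v" for v
  proof -
    have "R `` {v} = (R - T) `` {v} \<union> T `` {v}" using T(2) by blast
    moreover have "(R - T) `` {v} \<inter> T `` {v} = {}" by blast
    ultimately show ?thesis
      using H.finite_nbrs T.finite_nbrs by (simp add: e_def t_def card_Un_disjoint)
  qed
  \<comment> \<open>Because the tree holds all edges at x, the maximal degree of the graph is a tree
    degree, as the concentration argument requires.\<close>
  have t_x: "t x = deg x" by (simp add: t_def T(5))
  have e_x: "e x = 0" using split[of x] t_x by simp
  have sum_t: "(\<Sum>v\<in>V. t v) = 2 * (card V - 1)" using T.sum_degrees T(3) by (simp add: t_def)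
  have t_pos: "\<forall>v\<in>V. t v \<ge> 1"
    unfolding t_def using T.degree_pos[OF assms(1) x(1) T(4)] by blast
  have max': "\<forall>v\<in>V. e v + t v \<le> t x"
    unfolding split t_x using max by blast
  have "t x \<le> card V - 1" unfolding t_x by (rule degree_le[OF x(1)])
  note conc = concentrate_tree_degrees[OF finite_V x(1) assms(1) t_pos sum_t e_x max' this, unfolded split, folded rho_def]
  \<comment> \<open>The identity 1/(1 + e) = 1 - e/(1 + e) turns the rehung sum into n - 1 minus the
    spread of the remaining c edges.\<close>
  have "(\<Sum>v\<in>V - {x}. 1 / (1 + real (e v))) = (\<Sum>v\<in>V - {x}. 1 - real (e v) / (1 + real (e v)))"
    by (intro sum.cong) (auto simp: field_simps)
  also have "\<dots> = real (card V) - 1 - (\<Sum>v\<in>V - {x}. real (e v) / (1 + real (e v)))"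
    using finite_V x(1) assms(1) by (simp add: sum_subtractf of_nat_diff)
  also have "(\<Sum>v\<in>V - {x}. real (e v) / (1 + real (e v))) = (\<Sum>v\<in>V. real (e v) / (1 + real (e v)))"
    using e_x finite_V x(1) by (simp add: sum_diff1)
  finally have rest: "(\<Sum>v\<in>V - {x}. 1 / (1 + real (e v))) = real (card V) - 1 - (\<Sum>v\<in>V. real (e v) / (1 + real (e v)))" .
  have spread: "min_spread c \<le> (\<Sum>v\<in>V. real (e v) / (1 + real (e v)))"
    using H.min_spread_le[OF card_H assms(2)] by (simp add: e_def)
  show "rho \<le> B" using conc(1) rest spread unfolding B_def by linarith
  assume "rho = B"
  then have "rho = 1 / (real (card V) - 1) + (\<Sum>v\<in>V - {x}. 1 / (1 + real (e v)))"
    using conc(1) rest spread unfolding B_def by linarith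
  then have "\<forall>v\<in>V - {x}. t v = 1" using conc(2) by blast
  then have "(\<Sum>v\<in>V - {x}. t v) = card V - 1" using x(1) finite_V by simp
  then have "t x = card V - 1" using sum_t sum.remove[OF finite_V x(1), of t] by simp
  then show "\<exists>x\<in>V. deg x = card V - 1" using t_x x(1) by auto
qed

text \<open>Of the n - 1 + c edges, n - 1 lie at x, so c are left among the other vertices. For c =
  0 and c = 1 this determines the graph up to isomorphism.\<close>

lemma dominating_vertex:
  assumes x: "x \<in> V" "deg x = card V - 1"
  defines "H \<equiv> R \<inter> (V - {x}) \<times> (V - {x})"
  shows "simple_rel V H" "card H = 2 * c" "(x, v) \<in> R \<longleftrightarrow> v \<in> V - {x}"
    "v \<in> V - {x} \<Longrightarrow> deg v = Suc (card (H `` {v}))"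
proof -
  have "R `` {x} \<subseteq> V - {x}" using sub not_self by blast
  then have nbrs: "R `` {x} = V - {x}"
    using x finite_V by (intro card_subset_eq) auto
  then show mem: "(x, v) \<in> R \<longleftrightarrow> v \<in> V - {x}" for v by blast
  interpret H: simple_rel V H
    using finite_V symmetric_arc not_self
    by unfold_locales (auto simp: H_def irrefl_def intro!: symI)
  show "simple_rel V H" ..
  show deg: "deg v = Suc (card (H `` {v}))" if "v \<in> V - {x}" for v
  proof -
    have "R `` {v} = insert x (H `` {v})"
      using that mem[of v] symmetric_arc in_V unfolding H_def by blast
    moreover have "x \<notin> H `` {v}" by (auto simp: H_def)
    ultimately show ?thesis using H.finite_nbrs by simp
  qed
  have "H `` {x} = {}" by (auto simp: H_def)
  then have "card H = (\<Sum>v\<in>V - {x}. card (H `` {v}))"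
    using H.sum_degrees sum.remove[OF finite_V x(1), of "\<lambda>v. card (H `` {v})"] by simp
  moreover have "(\<Sum>v\<in>V - {x}. deg v) = (\<Sum>v\<in>V - {x}. card (H `` {v})) + (card V - 1)"
  proof -
    have "(\<Sum>v\<in>V - {x}. deg v) = (\<Sum>v\<in>V - {x}. card (H `` {v}) + 1)"
      by (rule sum.cong) (simp_all add: deg del: Diff_iff)
    then show ?thesis unfolding sum.distrib using x(1) finite_V by simp
  qed
  moreover have "(\<Sum>v\<in>V. deg v) = (card V - 1) + (\<Sum>v\<in>V - {x}. deg v)"
    using sum.remove[OF finite_V x(1), of deg] x(2) by simp
  moreover have "card V \<ge> 1" using x(1) finite_V card_gt_0_iff[of V] by auto
  ultimately show "card H = 2 * c" using sum_degrees card_R by presburger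
qed

text \<open>With at most one edge off x all other degrees are 1 or 2, where the chord for k = 1 is
  exact, so their reciprocals sum to a function of the degree sum alone. This is the converse of the
  equality clause of \<open>rho_upper\<close> for c \<le> 1, where \<open>min_spread c\<close> is
  c.\<close>

lemma rho_dominating_vertex:
  assumes x: "x \<in> V" "deg x = card V - 1" and "c \<le> 1" "card V \<ge> 2"
  shows "rho = 1 / (real (card V) - 1) + (real (card V) - 1) - real c"
proof -
  define H where "H = R \<inter> (V - {x}) \<times> (V - {x})"
  note dom = dominating_vertex[OF x, folded H_def]
  interpret H: simple_rel V H by (rule dom(1))
  have "card (H `` {v}) \<le> 1" for v
  proof (cases "c = 0")
    case True
    then have "H = {}" using dom(2) H.finite_R by simp
    then show ?thesis by simp
  next
    case False
    then have "card H = 2" using dom(2) assms(3) by simp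
    then obtain a b where "a \<noteq> b" "H = {(a, b), (b, a)}" by (rule H.two_arcs)
    then have "H `` {v} = (if v = a then {b} else if v = b then {a} else {})" by auto
    then show ?thesis by simp
  qed
  then have small: "\<forall>v\<in>V - {x}. deg v = 1 \<or> deg v = Suc 1"
    using dom(4) by (metis One_nat_def le_Suc_eq le_zero_eq)
  have "real (\<Sum>v\<in>V - {x}. deg v) = real (card V) - 1 + 2 * real c"
    using sum.remove[OF finite_V x(1), of deg] sum_deg x assms(4) by (simp add: of_nat_diff)
  moreover have "real (card (V - {x})) = real (card V) - 1"
    using x finite_V assms(4) by (simp add: of_nat_diff)
  moreover have "(\<Sum>v\<in>V - {x}. 1 / real (deg v))
      = ((2 * real 1 + 1) * real (card (V - {x})) - real (\<Sum>v\<in>V - {x}. deg v)) / (real 1 * (real 1 + 1))"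
  proof (rule sum_inverse_ge_chord(2)[THEN iffD2])
    show "deg v \<ge> 1" if "v \<in> V - {x}" for v using bspec[OF small that] by auto
  qed (use finite_V small in auto)
  ultimately have "(\<Sum>v\<in>V - {x}. 1 / real (deg v)) = real (card V) - 1 - real c"
    by simp
  then show ?thesis
    unfolding rho_def using sum.remove[OF finite_V x(1), of "\<lambda>v. 1 / real (deg v)"] x(2) assms(4)
    by (simp add: of_nat_diff)
qed

end

section \<open>Graphs attaining the bounds\<close>

lemma inverse_degree_of_degree_seq:
  assumes "has_degree_seq G ds"
  shows "inverse_degree G = (\<Sum>d\<leftarrow>ds. 1 / real d)"
proof -
  have "inverse_degree G = sum_mset (image_mset (\<lambda>d. 1 / real d) (image_mset (degree G) (mset_set (pverts G))))"
    by (simp add: inverse_degree_def sum_unfold_sum_mset image_mset.compositionality comp_def)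
  also have "\<dots> = sum_mset (image_mset (\<lambda>d. 1 / real d) (mset ds))"
    using assms by (simp add: has_degree_seq_def)
  finally show ?thesis by (simp add: sum_mset_sum_list flip: mset_map)
qed

text \<open>A smaller neighbour for every vertex but 0 gives connectedness by descent, and the sum
  of the degree sequence replaces the edge count.\<close>

lemma attained_byI:
  fixes P :: "nat \<Rightarrow> nat \<Rightarrow> bool"
  assumes n: "n \<ge> 1"
    and P_sym: "\<And>i j. P i j \<Longrightarrow> P j i"
    and P_irrefl: "\<And>i. \<not> P i i"
    and parent: "\<And>i. 0 < i \<Longrightarrow> i < n \<Longrightarrow> \<exists>j<i. P i j"
    and degrees: "image_mset (\<lambda>i. card {j. j < n \<and> P i j}) (mset_set {..<n}) = mset ds"
    and sum: "sum_list ds + 2 = 2 * (n + c)"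
    and r: "(\<Sum>d\<leftarrow>ds. 1 / real d) = r"
  shows "attained_by c n ds r"
proof -
  define H where "H = \<lparr> pverts = {..<n}, parcs = {(i, j). i < n \<and> j < n \<and> P i j} \<rparr>"
  have V: "pverts H = {..<n}" and E: "parcs H = {(i, j). i < n \<and> j < n \<and> P i j}"
    by (simp_all add: H_def)
  interpret simple_rel "pverts H" "parcs H"
    by unfold_locales (use P_sym P_irrefl in \<open>auto simp: V E irrefl_def intro: symI\<close>)
  have deg: "card (parcs H `` {i}) = card {j. j < n \<and> P i j}" if "i < n" for i
    using that by (auto simp: E intro: arg_cong[of _ _ card])
  have seq: "image_mset (\<lambda>i. card (parcs H `` {i})) (mset_set {..<n}) = mset ds"
    unfolding degrees[symmetric] by (rule image_mset_cong) (simp add: deg)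
  have "card (parcs H) = sum_mset (image_mset (\<lambda>i. card (parcs H `` {i})) (mset_set {..<n}))"
    unfolding sum_degrees[symmetric] V by (simp add: sum_unfold_sum_mset)
  then have card_E: "card (parcs H) = sum_list ds"
    unfolding seq by (simp add: sum_mset_sum_list)
  have from_0: "(0, i) \<in> (parcs H)\<^sup>*" if "i < n" for i
    using that
  proof (induction i rule: less_induct)
    case (less i)
    show ?case
    proof (cases "i = 0")
      case False
      then obtain j where j: "j < i" "P i j" using parent less.prems by blast
      then have "(j, i) \<in> parcs H" using P_sym less.prems by (simp add: E)
      then show ?thesis using less.IH[OF j(1)] j(1) less.prems by (simp add: rtrancl_into_rtrancl)
    qed simp
  qed
  have "(i, 0) \<in> (parcs H)\<^sup>*" if "i < n" for i
    using from_0[OF that] sym_rtrancl[OF sym] by (rule symD[rotated])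
  then have "(i, j) \<in> (parcs H)\<^sup>*" if "i < n" "j < n" for i j
    using from_0 that by (meson rtrancl_trans)
  then have "cyclic_rel (pverts H) (parcs H) c"
    by unfold_locales (use n sum in \<open>auto simp: V card_E lessThan_empty_iff\<close>)
  then have "c_cyclic c H" by (simp add: c_cyclic_iff)
  moreover have seq': "has_degree_seq H ds"
    using seq by (simp add: has_degree_seq_def degree_conv_card V)
  moreover have "inverse_degree H = r"
    using inverse_degree_of_degree_seq[OF seq'] r by simp
  moreover have "card (pverts H) = n" by (simp add: V)
  ultimately show ?thesis unfolding attained_by_def by blast
qed

text \<open>The conditions on the graph form one executable conjunction, which rewriting with code equations
  decides for a concrete edge list.\<close>

lemma attained_by_edge_list:
  fixes es :: "(nat \<times> nat) list"
  defines "P \<equiv> \<lambda>i j. (i, j) \<in> set es \<or> (j, i) \<in> set es"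
  assumes "n \<ge> 1 \<and> list_all (\<lambda>(i, j). i \<noteq> j) es
      \<and> list_all (\<lambda>i. list_ex (P i) [0..<i]) [1..<n]
      \<and> sort (map (\<lambda>i. length (filter (P i) [0..<n])) [0..<n]) = sort ds
      \<and> sum_list ds + 2 = 2 * (n + c)"
    and "(\<Sum>d\<leftarrow>ds. 1 / real d) = r"
  shows "attained_by c n ds r"
proof (rule attained_byI[where P = P])
  show "P j i" if "P i j" for i j using that by (auto simp: P_def)
  show "\<not> P i i" for i
    using assms(2) by (auto simp: P_def list_all_iff)
  show "\<exists>j<i. P i j" if "0 < i" "i < n" for i
  proof -
    have "list_all (\<lambda>i. list_ex (P i) [0..<i]) [1..<n]"
      using assms(2) by blast
    then have "list_ex (P i) [0..<i]" using that by (simp add: list_all_iff)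
    then show ?thesis by (auto simp: list_ex_iff)
  qed
  have "card {j. j < n \<and> P i j} = length (filter (P i) [0..<n])" for i
  proof -
    have "{j. j < n \<and> P i j} = set (filter (P i) [0..<n])" by auto
    then show ?thesis by (simp add: distinct_card del: set_filter)
  qed
  then have "image_mset (\<lambda>i. card {j. j < n \<and> P i j}) (mset_set {..<n})
      = mset (map (\<lambda>i. length (filter (P i) [0..<n])) [0..<n])"
    by (simp add: atLeast0LessThan[symmetric] mset_map)
  also have "\<dots> = mset ds" using assms(2) by (metis mset_sort)
  finally show "image_mset (\<lambda>i. card {j. j < n \<and> P i j}) (mset_set {..<n}) = mset ds" .
qed (use assms in auto)

text \<open>K_4 with the edge between 2 and 3 subdivided four times.\<close>

lemma attained_tricyclic_min:
  "attained_by 3 8 (replicate 4 3 @ replicate 4 2) (10/3)"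
  by (rule attained_by_edge_list[of 8
        "[(0,1),(0,2),(0,3),(1,2),(1,3),(2,4),(4,5),(5,6),(6,7),(7,3)]"], code_simp)
     (simp add: numeral_eq_Suc)

text \<open>Vertex 0 dominates and the other edges form a triangle. The later maxima likewise join 0
  to everything and add a graph attaining \<open>min_spread\<close>.\<close>

lemma attained_tricyclic_max:
  "attained_by 3 8 ([7] @ replicate 3 3 @ replicate 4 1) (36/7)"
  by (rule attained_by_edge_list[of 8
        "[(0,1),(0,2),(0,3),(0,4),(0,5),(0,6),(0,7),(1,2),(1,3),(2,3)]"], code_simp)
     (simp add: numeral_eq_Suc)

text \<open>A Hamiltonian cycle with three chords that share no endpoint. The pentacyclic and
  hexacyclic minima are built likewise, with c - 1 chords.\<close>

lemma attained_tetracyclic_min: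
  "attained_by 4 8 (replicate 6 3 @ replicate 2 2) 3"
  by (rule attained_by_edge_list[of 8
        "[(0,1),(1,2),(2,3),(3,4),(4,5),(5,6),(6,7),(7,0),(0,4),(1,5),(2,6)]"], code_simp)
     (simp add: numeral_eq_Suc)

lemma attained_tetracyclic_max:
  "attained_by 4 8 ([7, 4, 3, 3, 2] @ replicate 3 1) (3 + 1/7 + 17/12)"
  by (rule attained_by_edge_list[of 8
        "[(0,1),(0,2),(0,3),(0,4),(0,5),(0,6),(0,7),(1,2),(1,3),(1,4),(2,3)]"], code_simp)
     (simp add: numeral_eq_Suc)

lemma attained_pentacyclic_min:
  "attained_by 5 9 (replicate 8 3 @ [2]) (19/6)"
  by (rule attained_by_edge_list[of 9
        "[(0,1),(1,2),(2,3),(3,4),(4,5),(5,6),(6,7),(7,8),(8,0),(0,4),(1,5),(2,6),(3,7)]"], code_simp)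
     (simp add: numeral_eq_Suc)

lemma attained_pentacyclic_max:
  "attained_by 5 9 ([8, 4, 4, 3, 3] @ replicate 4 1) (4 + 1/8 + 7/6)"
  by (rule attained_by_edge_list[of 9
        "[(0,1),(0,2),(0,3),(0,4),(0,5),(0,6),(0,7),(0,8),(1,2),(1,3),(1,4),(2,3),(2,4)]"], code_simp)
     (simp add: numeral_eq_Suc)

lemma attained_hexacyclic_min:
  "attained_by 6 11 (replicate 10 3 @ [2]) (23/6)"
  by (rule attained_by_edge_list[of 11
        "[(0,1),(1,2),(2,3),(3,4),(4,5),(5,6),(6,7),(7,8),(8,9),(9,10),(10,0),(0,5),(1,6),(2,7),(3,8),(4,9)]"], code_simp)
     (simp add: numeral_eq_Suc)

lemma attained_hexacyclic_max:
  "attained_by 6 11 ([10] @ replicate 4 4 @ replicate 6 1) (71/10)"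
  by (rule attained_by_edge_list[of 11
        "[(0,1),(0,2),(0,3),(0,4),(0,5),(0,6),(0,7),(0,8),(0,9),(0,10),(1,2),(1,3),(1,4),(2,3),(2,4),(3,4)]"], code_simp)
     (simp add: numeral_eq_Suc)

lemma image_mset_eq_replicate:
  assumes "finite A" "\<And>i. i \<in> A \<Longrightarrow> f i = k"
  shows "image_mset f (mset_set A) = replicate_mset (card A) k"
proof -
  have "image_mset f (mset_set A) = image_mset (\<lambda>_. k) (mset_set A)"
    using assms by (intro image_mset_cong) simp
  then show ?thesis by (simp add: image_mset_const_eq)
qed

text \<open>An n-cycle with the chord from 0 to 2. For n \<ge> 4 the vertices 2 and n - 1 differ, so
  the chord is not an edge of the cycle.\<close>

lemma attained_bicyclic_min:
  assumes "n \<ge> 4"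
  shows "attained_by 2 n ([3, 3] @ replicate (n - 2) 2) ((real n - 2) / 2 + 2 / 3)"
proof -
  define P where "P i j \<longleftrightarrow> j = Suc i \<or> i = Suc j \<or> i = 0 \<and> (j = n - 1 \<or> j = 2) \<or> j = 0 \<and> (i = n - 1 \<or> i = 2)"
    for i j
  have "{j. j < n \<and> P 0 j} = {1, 2, n - 1}" using assms by (auto simp: P_def)
  then have N0: "card {j. j < n \<and> P 0 j} = 3" using assms by simp
  have "{j. j < n \<and> P 2 j} = {0, 1, 3}" using assms by (auto simp: P_def)
  then have N2: "card {j. j < n \<and> P 2 j} = 3" by simp
  have N: "{j. j < n \<and> P i j} = {i - 1, if Suc i = n then 0 else Suc i}" if "i < n" "i \<noteq> 0" "i \<noteq> 2" for i
    using assms that by (auto simp: P_def)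
  have deg: "card {j. j < n \<and> P i j} = 2" if "i \<in> {..<n} - {0, 2}" for i
    using assms that by (subst N) auto
  have V: "mset_set {..<n} = {#0, 2#} + mset_set ({..<n} - {0, 2})"
  proof -
    have "{..<n} = insert 0 (insert 2 ({..<n} - {0, 2}))" using assms by auto
    then have "mset_set {..<n} = mset_set (insert 0 (insert 2 ({..<n} - {0, 2})))" by simp
    then show ?thesis by simp
  qed
  have "card ({..<n} - {0, 2}) = n - 2" using assms by (subst card_Diff_subset) auto
  then have seq: "image_mset (\<lambda>i. card {j. j < n \<and> P i j}) (mset_set {..<n}) = mset ([3, 3] @ replicate (n - 2) 2)"
    unfolding V using assms image_mset_eq_replicate[of "{..<n} - {0, 2}", OF _ deg] by (simp add: N0 N2)
  show ?thesis
  proof (rule attained_byI[where P = P])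
    show "\<exists>j<i. P i j" if "0 < i" "i < n" for i
      using that by (intro exI[of _ "i - 1"]) (auto simp: P_def)
  qed (use assms seq in \<open>auto simp: P_def sum_list_replicate of_nat_diff field_simps\<close>)
qed

text \<open>Vertex 0 dominates, and the two further edges form the path 2 - 1 - 3.\<close>

lemma attained_bicyclic_max:
  assumes "n \<ge> 4"
  shows "attained_by 2 n ([n - 1, 3, 2, 2] @ replicate (n - 4) 1) ((real n - 3) + 1 / (real n - 1) + 1 / 3)"
proof -
  define P where "P i j \<longleftrightarrow> i \<noteq> j \<and> (i = 0 \<or> j = 0) \<or> i = 1 \<and> (j = 2 \<or> j = 3) \<or> j = 1 \<and> (i = 2 \<or> i = 3)"
    for i j :: nat
  have N0: "{j. j < n \<and> P 0 j} = {1..<n}" by (auto simp: P_def)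
  have "{j. j < n \<and> P 1 j} = {0, 2, 3}" using assms by (auto simp: P_def)
  then have N1: "card {j. j < n \<and> P 1 j} = 3" by simp
  have "{j. j < n \<and> P 2 j} = {0, 1}" using assms by (auto simp: P_def)
  then have N2: "card {j. j < n \<and> P 2 j} = 2" by simp
  have "{j. j < n \<and> P 3 j} = {0, 1}" using assms by (auto simp: P_def)
  then have N3: "card {j. j < n \<and> P 3 j} = 2" by simp
  have N: "{j. j < n \<and> P i j} = {0}" if "i \<in> {4..<n}" for i
    using assms that by (auto simp: P_def)
  have deg: "card {j. j < n \<and> P i j} = 1" if "i \<in> {4..<n}" for i
    using N[OF that] by simp
  have V: "mset_set {..<n} = {#0, 1, 2, 3#} + mset_set {4..<n}"
  proof -
    have "{..<n} = insert 0 (insert 1 (insert 2 (insert 3 {4..<n})))" using assms by auto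
    then have "mset_set {..<n} = mset_set (insert 0 (insert 1 (insert 2 (insert 3 {4..<n}))))" by simp
    then show ?thesis by simp
  qed
  have seq: "image_mset (\<lambda>i. card {j. j < n \<and> P i j}) (mset_set {..<n}) = mset ([n - 1, 3, 2, 2] @ replicate (n - 4) 1)"
    unfolding V using assms image_mset_eq_replicate[of "{4..<n}", OF _ deg] by (simp add: N0 N1[simplified] N2 N3)
  show ?thesis
  proof (rule attained_byI[where P = P])
    show "\<exists>j<i. P i j" if "0 < i" "i < n" for i
      using that by (intro exI[of _ 0]) (auto simp: P_def)
  qed (use assms seq in \<open>auto simp: P_def sum_list_replicate of_nat_diff\<close>)
qed

section \<open>Extremal trees and unicyclic graphs\<close>

text \<open>The degree condition is the one delivered by the equality case of the chord bound. One
  direction compares degree sets; the other uses the numbering by distance from a leaf.\<close>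

lemma isomorphic_path_graph_iff:
  assumes G: "cyclic_rel (pverts G) (parcs G) 0" and n: "card (pverts G) = n" "n \<ge> 2"
  shows "isomorphic G (path_graph n) \<longleftrightarrow> (\<forall>v\<in>pverts G. card (parcs G `` {v}) \<le> 2)"
proof
  interpret cyclic_rel "pverts G" "parcs G" 0 by (rule G)
  have graph: "pair_graph G" using simple_rel_axioms by (simp add: pair_graph_iff_simple_rel)
  {
    assume "isomorphic G (path_graph n)"
    note degs = isomorphic_degree_set[OF graph this]
    have "card (parcs (path_graph n) `` {i}) \<le> 2" for i :: nat
    proof -
      \<comment> \<open>Only an upper bound is wanted, so the truncated i - 1 = 0 at i = 0 does no
        harm.\<close>
      have "card (parcs (path_graph n) `` {i}) \<le> card {Suc i, i - 1}"
        by (rule card_mono) (auto simp: path_graph_def)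
      also have "\<dots> \<le> 2" by (simp add: card_insert_if)
      finally show ?thesis .
    qed
    then have "\<forall>d\<in>(\<lambda>v. card (parcs G `` {v})) ` pverts G. d \<le> 2" unfolding degs by blast
    then show "\<forall>v\<in>pverts G. card (parcs G `` {v}) \<le> 2" by simp
  }
  assume "\<forall>v\<in>pverts G. card (parcs G `` {v}) \<le> 2"
  then obtain f where f: "bij_betw f (pverts G) {..<card (pverts G)}"
      "\<forall>a\<in>pverts G. \<forall>b\<in>pverts G. (a, b) \<in> parcs G \<longleftrightarrow> f a = Suc (f b) \<or> f b = Suc (f a)"
    using tree_path_order n by auto
  show "isomorphic G (path_graph n)"
  proof (rule isomorphicI[OF graph])
    show bij: "bij_betw f (pverts G) (pverts (path_graph n))"
      using f(1) n by (simp add: path_graph_def)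
    show "(f a, f b) \<in> parcs (path_graph n) \<longleftrightarrow> (a, b) \<in> parcs G"
      if "a \<in> pverts G" "b \<in> pverts G" for a b
    proof -
      have "f a < n" "f b < n" using f(1) n that by (auto simp: bij_betw_def)
      moreover have "(a, b) \<in> parcs G \<longleftrightarrow> f a = Suc (f b) \<or> f b = Suc (f a)"
        using f(2) that by simp
      ultimately show ?thesis by (auto simp: path_graph_def)
    qed
  qed (auto simp: path_graph_def)
qed

text \<open>The successor modulo n wraps around only at n - 1; the resolved form is the adjacency
  that \<open>unicyclic_cycle_order\<close> produces.\<close>

lemma cycle_adjacent_iff:
  fixes i j n :: nat
  assumes "i < n" "j < n"
  shows "j = Suc i mod n \<or> i = Suc j mod n \<longleftrightarrow>
    i = Suc j \<or> j = Suc i \<or> i = 0 \<and> j = n - 1 \<or> j = 0 \<and> i = n - 1"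
proof -
  have "Suc i mod n = (if Suc i = n then 0 else Suc i)" if "i < n" for i
    using that by simp
  then show ?thesis using assms by auto
qed

lemma isomorphic_cycle_graph_iff:
  assumes G: "cyclic_rel (pverts G) (parcs G) 1" and n: "card (pverts G) = n" "n \<ge> 3"
  shows "isomorphic G (cycle_graph n) \<longleftrightarrow> (\<forall>v\<in>pverts G. card (parcs G `` {v}) \<le> 2)"
proof
  interpret cyclic_rel "pverts G" "parcs G" 1 by (rule G)
  have graph: "pair_graph G" using simple_rel_axioms by (simp add: pair_graph_iff_simple_rel)
  {
    assume "isomorphic G (cycle_graph n)"
    note degs = isomorphic_degree_set[OF graph this]
    have "card (parcs (cycle_graph n) `` {i}) \<le> 2" for i :: nat
    proof -
      have "parcs (cycle_graph n) `` {i} \<subseteq> {if Suc i = n then 0 else Suc i, if i = 0 then n - 1 else i - 1}"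
      proof
        fix j assume "j \<in> parcs (cycle_graph n) `` {i}"
        then have less: "i < n" "j < n" and adj: "j = Suc i mod n \<or> i = Suc j mod n"
          by (auto simp: cycle_graph_def)
        from adj have "i = Suc j \<or> j = Suc i \<or> i = 0 \<and> j = n - 1 \<or> j = 0 \<and> i = n - 1"
          unfolding cycle_adjacent_iff[OF less] .
        then show "j \<in> {if Suc i = n then 0 else Suc i, if i = 0 then n - 1 else i - 1}"
          using less by auto
      qed
      then have "card (parcs (cycle_graph n) `` {i})
          \<le> card {if Suc i = n then 0 else Suc i, if i = 0 then n - 1 else i - 1}"
        by (intro card_mono) simp_all
      also have "\<dots> \<le> 2" by (simp add: card_insert_if)
      finally show ?thesis .
    qed
    then have "\<forall>d\<in>(\<lambda>v. card (parcs G `` {v})) ` pverts G. d \<le> 2" unfolding degs by blast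
    then show "\<forall>v\<in>pverts G. card (parcs G `` {v}) \<le> 2" by simp
  }
  assume "\<forall>v\<in>pverts G. card (parcs G `` {v}) \<le> 2"
  then have "\<forall>v\<in>pverts G. card (parcs G `` {v}) = 2" using unicyclic_all_deg_two by blast
  then obtain f where f: "bij_betw f (pverts G) {..<card (pverts G)}"
      "\<forall>a\<in>pverts G. \<forall>b\<in>pverts G. (a, b) \<in> parcs G \<longleftrightarrow> f a = Suc (f b) \<or> f b = Suc (f a)
        \<or> f a = 0 \<and> f b = card (pverts G) - 1 \<or> f b = 0 \<and> f a = card (pverts G) - 1"
    using unicyclic_cycle_order n by auto
  show "isomorphic G (cycle_graph n)"
  proof (rule isomorphicI[OF graph])
    show bij: "bij_betw f (pverts G) (pverts (cycle_graph n))"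
      using f(1) n by (simp add: cycle_graph_def)
    show "(f a, f b) \<in> parcs (cycle_graph n) \<longleftrightarrow> (a, b) \<in> parcs G"
      if "a \<in> pverts G" "b \<in> pverts G" for a b
    proof -
      have less: "f a < n" "f b < n" using f(1) n that by (auto simp: bij_betw_def)
      have "(f a, f b) \<in> parcs (cycle_graph n) \<longleftrightarrow> f b = Suc (f a) mod n \<or> f a = Suc (f b) mod n"
        using less by (simp add: cycle_graph_def)
      also have "\<dots> \<longleftrightarrow> (a, b) \<in> parcs G"
        unfolding cycle_adjacent_iff[OF less] using f(2) that n by simp
      finally show ?thesis .
    qed
  qed (auto simp: cycle_graph_def)
qed

text \<open>In a tree no edge avoids a vertex of degree n - 1, so any numbering that sends this
  vertex to 0 is an isomorphism.\<close>

lemma isomorphic_star_graph_iff: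
  assumes G: "cyclic_rel (pverts G) (parcs G) 0" and n: "card (pverts G) = n" "n \<ge> 2"
  shows "isomorphic G (star_graph n) \<longleftrightarrow> (\<exists>x\<in>pverts G. card (parcs G `` {x}) = n - 1)"
proof
  interpret cyclic_rel "pverts G" "parcs G" 0 by (rule G)
  have graph: "pair_graph G" using simple_rel_axioms by (simp add: pair_graph_iff_simple_rel)
  {
    assume "isomorphic G (star_graph n)"
    note degs = isomorphic_degree_set[OF graph this]
    have "parcs (star_graph n) `` {0} = {1..<n}" using n by (auto simp: star_graph_def)
    moreover have "0 \<in> pverts (star_graph n)" using n by (simp add: star_graph_def)
    ultimately have "n - 1 \<in> (\<lambda>w. card (parcs (star_graph n) `` {w})) ` pverts (star_graph n)"
      by (intro image_eqI[where x = 0]) simp_all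
    then show "\<exists>x\<in>pverts G. card (parcs G `` {x}) = n - 1" unfolding degs[symmetric] by force
  }
  assume "\<exists>x\<in>pverts G. card (parcs G `` {x}) = n - 1"
  then obtain x where x: "x \<in> pverts G" "card (parcs G `` {x}) = card (pverts G) - 1" using n by blast
  note dom = dominating_vertex[OF x]
  have "finite (parcs G \<inter> (pverts G - {x}) \<times> (pverts G - {x}))"
    using finite_R by simp
  then have empty: "parcs G \<inter> (pverts G - {x}) \<times> (pverts G - {x}) = {}" using dom(2) by simp
  obtain f where f: "bij_betw f (pverts G) {..<card (pverts G)}" "\<And>i. i < length [x] \<Longrightarrow> f ([x] ! i) = i"
    by (rule numbering_extending[OF finite_V, of "[x]"]) (use x(1) in auto)
  have f_x: "f x = 0" using f(2)[of 0] by simp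
  show "isomorphic G (star_graph n)"
  proof (rule isomorphicI[OF graph])
    show bij: "bij_betw f (pverts G) (pverts (star_graph n))"
      using f(1) n by (simp add: star_graph_def)
    show "(f a, f b) \<in> parcs (star_graph n) \<longleftrightarrow> (a, b) \<in> parcs G"
      if ab: "a \<in> pverts G" "b \<in> pverts G" for a b
    proof -
      have less: "f a < n" "f b < n" using f(1) n ab by (auto simp: bij_betw_def)
      have inj: "f u = f v \<longleftrightarrow> u = v" if "u \<in> pverts G" "v \<in> pverts G" for u v
        using f(1) that by (auto simp: bij_betw_def dest: inj_onD)
      have "(f a, f b) \<in> parcs (star_graph n) \<longleftrightarrow> a \<noteq> b \<and> (a = x \<or> b = x)"
        using less inj[OF ab] inj[OF ab(1) x(1)] inj[OF ab(2) x(1)] f_x by (simp add: star_graph_def)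
      also have "\<dots> \<longleftrightarrow> (a, b) \<in> parcs G"
      proof
        assume "a \<noteq> b \<and> (a = x \<or> b = x)"
        then show "(a, b) \<in> parcs G" using dom(3)[of a] dom(3)[of b] ab symmetric_arc by auto
      next
        assume ab': "(a, b) \<in> parcs G"
        then have "a \<noteq> b" using not_self by blast
        moreover have "a = x \<or> b = x" using empty ab' ab by blast
        ultimately show "a \<noteq> b \<and> (a = x \<or> b = x)" by blast
      qed
      finally show ?thesis .
    qed
  qed (auto simp: star_graph_def)
qed

text \<open>Exactly one edge avoids the dominating vertex. Giving its ends the numbers 1 and 2
  matches the extra edge of the model, and the remaining numbers are arbitrary.\<close>

lemma isomorphic_star_plus_graph_iff:
  assumes G: "cyclic_rel (pverts G) (parcs G) 1" and n: "card (pverts G) = n" "n \<ge> 3"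
  shows "isomorphic G (star_plus_graph n) \<longleftrightarrow> (\<exists>x\<in>pverts G. card (parcs G `` {x}) = n - 1)"
proof
  interpret cyclic_rel "pverts G" "parcs G" 1 by (rule G)
  have graph: "pair_graph G" using simple_rel_axioms by (simp add: pair_graph_iff_simple_rel)
  {
    assume "isomorphic G (star_plus_graph n)"
    note degs = isomorphic_degree_set[OF graph this]
    have "parcs (star_plus_graph n) `` {0} = {1..<n}" using n by (auto simp: star_plus_graph_def star_graph_def)
    moreover have "0 \<in> pverts (star_plus_graph n)" using n by (simp add: star_plus_graph_def)
    ultimately have "n - 1 \<in> (\<lambda>w. card (parcs (star_plus_graph n) `` {w})) ` pverts (star_plus_graph n)"
      by (intro image_eqI[where x = 0]) simp_all
    then show "\<exists>x\<in>pverts G. card (parcs G `` {x}) = n - 1" unfolding degs[symmetric] by force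
  }
  assume "\<exists>x\<in>pverts G. card (parcs G `` {x}) = n - 1"
  then obtain x where x: "x \<in> pverts G" "card (parcs G `` {x}) = card (pverts G) - 1" using n by blast
  define H where "H = parcs G \<inter> (pverts G - {x}) \<times> (pverts G - {x})"
  note dom = dominating_vertex[OF x, folded H_def]
  have "card H = 2" using dom(2) by simp
  then obtain u v where uv: "u \<noteq> v" "H = {(u, v), (v, u)}" by (rule simple_rel.two_arcs[OF dom(1)])
  have "(u, v) \<in> H" using uv(2) by simp
  then have V: "u \<in> pverts G" "v \<in> pverts G" "u \<noteq> x" "v \<noteq> x" unfolding H_def by auto
  obtain f where f: "bij_betw f (pverts G) {..<card (pverts G)}"
      "\<And>i. i < length [x, u, v] \<Longrightarrow> f ([x, u, v] ! i) = i"
    by (rule numbering_extending[OF finite_V, of "[x, u, v]"]) (use x(1) V uv(1) in auto)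
  have f_xuv: "f x = 0" "f u = 1" "f v = 2" using f(2)[of 0] f(2)[of 1] f(2)[of 2] by simp_all
  show "isomorphic G (star_plus_graph n)"
  proof (rule isomorphicI[OF graph])
    show bij: "bij_betw f (pverts G) (pverts (star_plus_graph n))"
      using f(1) n by (simp add: star_plus_graph_def)
    show "(f a, f b) \<in> parcs (star_plus_graph n) \<longleftrightarrow> (a, b) \<in> parcs G"
      if ab: "a \<in> pverts G" "b \<in> pverts G" for a b
    proof -
      have less: "f a < n" "f b < n" using f(1) n ab by (auto simp: bij_betw_def)
      have inj: "f y = f z \<longleftrightarrow> y = z" if "y \<in> pverts G" "z \<in> pverts G" for y z
        using f(1) that by (auto simp: bij_betw_def dest: inj_onD)
      have eqs: "f a = 0 \<longleftrightarrow> a = x" "f b = 0 \<longleftrightarrow> b = x" "f a = 1 \<longleftrightarrow> a = u" "f b = 1 \<longleftrightarrow> b = u"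
          "f a = 2 \<longleftrightarrow> a = v" "f b = 2 \<longleftrightarrow> b = v"
        using inj[OF ab(1) x(1)] inj[OF ab(2) x(1)] inj[OF ab(1) V(1)] inj[OF ab(2) V(1)]
          inj[OF ab(1) V(2)] inj[OF ab(2) V(2)] unfolding f_xuv .
      have "(f a, f b) \<in> parcs (star_plus_graph n)
          \<longleftrightarrow> f a \<noteq> f b \<and> (f a = 0 \<or> f b = 0) \<or> f a = 1 \<and> f b = 2 \<or> f a = 2 \<and> f b = 1"
        using less by (auto simp: star_plus_graph_def star_graph_def)
      also have "\<dots> \<longleftrightarrow> a \<noteq> b \<and> (a = x \<or> b = x) \<or> (a, b) \<in> H"
        unfolding eqs inj[OF ab] uv(2) by simp
      also have "\<dots> \<longleftrightarrow> (a, b) \<in> parcs G"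
      proof
        assume "a \<noteq> b \<and> (a = x \<or> b = x) \<or> (a, b) \<in> H"
        then show "(a, b) \<in> parcs G"
          using dom(3)[of a] dom(3)[of b] ab symmetric_arc by (auto simp: H_def)
      next
        assume ab': "(a, b) \<in> parcs G"
        then have "a \<noteq> b" using not_self by blast
        moreover have "a = x \<or> b = x \<or> (a, b) \<in> H" using ab' ab by (auto simp: H_def)
        ultimately show "a \<noteq> b \<and> (a = x \<or> b = x) \<or> (a, b) \<in> H" by blast
      qed
      finally show ?thesis .
    qed
  qed (use n in \<open>auto simp: star_plus_graph_def star_graph_def\<close>)
qed

text \<open>For c \<ge> 2 attainment is expressed by two facts per bound: an implication for every G
  with the degree sequence, and \<open>attained_by\<close>, which shows that such graphs exist and
  the implication is not vacuous.\<close>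

theorem mainTheorem4:
  fixes G :: "'a pair_pre_digraph" and c n :: nat
  assumes "c_cyclic c G"
    and "card (pverts G) = n"
    and "c \<le> 6"
    and "n \<ge> c + 2"
  shows
    "(c = 0 \<longrightarrow>
       (real n + 2) / 2 \<le> inverse_degree G \<and>
       inverse_degree G \<le> (real n - 1) + 1 / (real n - 1) \<and>
       (inverse_degree G = (real n + 2) / 2 \<longleftrightarrow> isomorphic G (path_graph n)) \<and>
       (inverse_degree G = (real n - 1) + 1 / (real n - 1) \<longleftrightarrow> isomorphic G (star_graph n))) \<and>
     (c = 1 \<longrightarrow>
       real n / 2 \<le> inverse_degree G \<and>
       inverse_degree G \<le> (real n - 2) + 1 / (real n - 1) \<and>
       (inverse_degree G = real n / 2 \<longleftrightarrow> isomorphic G (cycle_graph n)) \<and>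
       (inverse_degree G = (real n - 2) + 1 / (real n - 1) \<longleftrightarrow> isomorphic G (star_plus_graph n))) \<and>
     (c = 2 \<longrightarrow>
       (real n - 2) / 2 + 2 / 3 \<le> inverse_degree G \<and>
       inverse_degree G \<le> (real n - 3) + 1 / (real n - 1) + 1 / 3 \<and>
       (has_degree_seq G ([3, 3] @ replicate (n - 2) 2) \<longrightarrow>
         inverse_degree G = (real n - 2) / 2 + 2 / 3) \<and>
       attained_by 2 n ([3, 3] @ replicate (n - 2) 2) ((real n - 2) / 2 + 2 / 3) \<and>
       (has_degree_seq G ([n - 1, 3, 2, 2] @ replicate (n - 4) 1) \<longrightarrow>
         inverse_degree G = (real n - 3) + 1 / (real n - 1) + 1 / 3) \<and>
       attained_by 2 n ([n - 1, 3, 2, 2] @ replicate (n - 4) 1) ((real n - 3) + 1 / (real n - 1) + 1 / 3)) \<and>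
     (c = 3 \<longrightarrow>
       (real n - 4) / 2 + 4 / 3 \<le> inverse_degree G \<and>
       inverse_degree G \<le> (real n - 3) + 1 / (real n - 1) \<and>
       (n = 8 \<longrightarrow>
        (has_degree_seq G (replicate 4 3 @ replicate 4 2) \<longrightarrow>
          inverse_degree G = (real n - 4) / 2 + 4 / 3) \<and>
        attained_by 3 n (replicate 4 3 @ replicate 4 2) ((real n - 4) / 2 + 4 / 3) \<and>
        (has_degree_seq G ([7] @ replicate 3 3 @ replicate 4 1) \<longrightarrow>
          inverse_degree G = (real n - 3) + 1 / (real n - 1)) \<and>
        attained_by 3 n ([7] @ replicate 3 3 @ replicate 4 1) ((real n - 3) + 1 / (real n - 1)))) \<and>
     (c = 4 \<longrightarrow>
       (real n - 2) / 2 \<le> inverse_degree G \<and>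
       inverse_degree G \<le> (real n - 5) + 1 / (real n - 1) + 17 / 12 \<and>
       (n = 8 \<longrightarrow>
        (has_degree_seq G (replicate 6 3 @ replicate 2 2) \<longrightarrow>
          inverse_degree G = (real n - 2) / 2) \<and>
        attained_by 4 n (replicate 6 3 @ replicate 2 2) ((real n - 2) / 2) \<and>
        (has_degree_seq G ([7, 4, 3, 3, 2] @ replicate 3 1) \<longrightarrow>
          inverse_degree G = (real n - 5) + 1 / (real n - 1) + 17 / 12) \<and>
        attained_by 4 n ([7, 4, 3, 3, 2] @ replicate 3 1) ((real n - 5) + 1 / (real n - 1) + 17 / 12))) \<and>
     (c = 5 \<longrightarrow>
       (real n - 8) / 2 + 8 / 3 \<le> inverse_degree G \<and>
       inverse_degree G \<le> (real n - 5) + 1 / (real n - 1) + 7 / 6 \<and>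
       (n = 9 \<longrightarrow>
        (has_degree_seq G (replicate 8 3 @ [2]) \<longrightarrow>
          inverse_degree G = (real n - 8) / 2 + 8 / 3) \<and>
        attained_by 5 n (replicate 8 3 @ [2]) ((real n - 8) / 2 + 8 / 3) \<and>
        (has_degree_seq G ([8, 4, 4, 3, 3] @ replicate 4 1) \<longrightarrow>
          inverse_degree G = (real n - 5) + 1 / (real n - 1) + 7 / 6) \<and>
        attained_by 5 n ([8, 4, 4, 3, 3] @ replicate 4 1) ((real n - 5) + 1 / (real n - 1) + 7 / 6))) \<and>
     (c = 6 \<longrightarrow>
       (real n - 10) / 2 + 10 / 3 \<le> inverse_degree G \<and>
       inverse_degree G \<le> (real n - 4) + 1 / (real n - 1) \<and>
       (n = 11 \<longrightarrow>
        (has_degree_seq G (replicate 10 3 @ [2]) \<longrightarrow>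
          inverse_degree G = (real n - 10) / 2 + 10 / 3) \<and>
        attained_by 6 n (replicate 10 3 @ [2]) ((real n - 10) / 2 + 10 / 3) \<and>
        (has_degree_seq G ([10] @ replicate 4 4 @ replicate 6 1) \<longrightarrow>
          inverse_degree G = (real n - 4) + 1 / (real n - 1)) \<and>
        attained_by 6 n ([10] @ replicate 4 4 @ replicate 6 1) ((real n - 4) + 1 / (real n - 1))))"
proof -
  interpret cyclic_rel "pverts G" "parcs G" c
    using assms(1) by (simp add: c_cyclic_iff)
  have n: "card (pverts G) = n" "n \<ge> 2" using assms(2,4) by auto
  have rho: "inverse_degree G = rho"
    by (simp add: inverse_degree_def rho_def degree_conv_card)
  have lower: "real n / 2 - (real c - 1) / 3 \<le> inverse_degree G"
    using rho_lower(1) n unfolding rho by simp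
  have upper: "inverse_degree G \<le> 1 / (real n - 1) + (real n - 1) - min_spread c"
    using rho_upper(1) n assms(3) unfolding rho by simp
  \<comment> \<open>For c \<le> 1 at most one edge avoids a dominating vertex, so its existence
    fixes the inverse degree and the equality clause of \<open>rho_upper\<close> becomes an
    equivalence.\<close>
  have upper_eq: "inverse_degree G = 1 / (real n - 1) + (real n - 1) - min_spread c
      \<longleftrightarrow> (\<exists>x\<in>pverts G. card (parcs G `` {x}) = n - 1)" if "c \<le> 1"
  proof -
    have "min_spread c = real c" using that by (cases c) simp_all
    then show ?thesis
      using rho_upper(2) rho_dominating_vertex[OF _ _ that] n assms(3) unfolding rho by auto
  qed
  have tree: "(real n + 2) / 2 \<le> inverse_degree G \<and>
      (inverse_degree G = (real n + 2) / 2 \<longleftrightarrow> isomorphic G (path_graph n)) \<and>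
      (inverse_degree G = (real n - 1) + 1 / (real n - 1) \<longleftrightarrow> isomorphic G (star_graph n))"
    if "c = 0"
  proof -
    have G0: "cyclic_rel (pverts G) (parcs G) 0" using cyclic_rel_axioms that by simp
    have "inverse_degree G = (real n - 1) + 1 / (real n - 1) \<longleftrightarrow> isomorphic G (star_graph n)"
      unfolding isomorphic_star_graph_iff[OF G0 n] using upper_eq that by (simp add: add.commute)
    then show ?thesis
      unfolding isomorphic_path_graph_iff[OF G0 n]
      using rho_lower_tree[OF that] n unfolding rho by simp
  qed
  have unicyclic: "(inverse_degree G = real n / 2 \<longleftrightarrow> isomorphic G (cycle_graph n)) \<and>
      (inverse_degree G = (real n - 2) + 1 / (real n - 1) \<longleftrightarrow> isomorphic G (star_plus_graph n))"
    if "c = 1"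
  proof -
    have G1: "cyclic_rel (pverts G) (parcs G) 1" using cyclic_rel_axioms that by simp
    have n3: "n \<ge> 3" using assms(4) that by simp
    have bound: "(real n - 2) + 1 / (real n - 1) = 1 / (real n - 1) + (real n - 1) - min_spread c"
      using that by simp
    have "inverse_degree G = (real n - 2) + 1 / (real n - 1) \<longleftrightarrow> isomorphic G (star_plus_graph n)"
      unfolding isomorphic_star_plus_graph_iff[OF G1 n(1) n3] bound using upper_eq that by simp
    then show ?thesis
      unfolding isomorphic_cycle_graph_iff[OF G1 n(1) n3]
      using rho_lower_unicyclic[OF that] n unfolding rho by simp
  qed
  have "c = 0 \<or> c = 1 \<or> c = 2 \<or> c = 3 \<or> c = 4 \<or> c = 5 \<or> c = 6" using assms(3) by linarith
  then show ?thesis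
  proof (elim disjE)
    assume c: "c = 0"
    show ?thesis using tree[OF c] upper c by simp
  next
    assume c: "c = 1"
    show ?thesis using unicyclic[OF c] lower upper c by simp
  next
    assume c: "c = 2"
    then have "n \<ge> 4" using assms(4) by simp
    then show ?thesis
      using lower upper c attained_bicyclic_min attained_bicyclic_max
      by (auto simp: sum_list_replicate of_nat_diff field_simps dest!: inverse_degree_of_degree_seq)
  next
    assume c: "c = 3"
    then show ?thesis
      using lower upper attained_tricyclic_min attained_tricyclic_max
      by (auto simp: sum_list_replicate diff_divide_distrib dest!: inverse_degree_of_degree_seq)
  next
    assume c: "c = 4"
    then show ?thesis
      using lower upper attained_tetracyclic_min attained_tetracyclic_max
      by (auto simp: sum_list_replicate diff_divide_distrib dest!: inverse_degree_of_degree_seq)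
  next
    assume c: "c = 5"
    then show ?thesis
      using lower upper attained_pentacyclic_min attained_pentacyclic_max
      by (auto simp: sum_list_replicate diff_divide_distrib dest!: inverse_degree_of_degree_seq)
  next
    assume c: "c = 6"
    then show ?thesis
      using lower upper attained_hexacyclic_min attained_hexacyclic_max
      by (auto simp: sum_list_replicate diff_divide_distrib dest!: inverse_degree_of_degree_seq)
  qed
qed

end
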